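(* Let $\varepsilon\in(0,1)$ and let $p=p(n)$ satisfy $np\in[1-\varepsilon, n^{1-\varepsilon}]$. Let $G\in\mathcal{G}(n,p)$. Then there is a constant $C_4=C_4(\varepsilon)$ such that asymptotically almost surely \[\tfrac{\varepsilon}{41}\cdot np\le \mathrm{lbox}(G)\le C_4\cdot np.\]
   Context: The random graph $G\in\mathcal{G}(n,p)$ is obtained from the empty graph on $n$ vertices by adding each of the $\binom{n}{2}$ possible edges independently with probability $p$. An event sequence $(A_n)$ holds asymptotically almost surely if $\mathbb{P}(A_n)\to 1$ as $n\to\infty$. A real interval is either a bounded interval of $\mathbb{R}$ or $\mathbb{R}$ itself. For an integer $d'\ge 1$, a $d'$-box is a Cartesian product $I_1\times\cdots\times I_{d'}$ of real intervals; it is local in dimension $i$ if $I_i$ is bounded. A $d$-local box in dimension $d'\ge d$ is a $d'$-box that is local in at most $d$ dimensions. The local boxicity $\mathrm{lbox}(G)$ of a graph $G$ is the minimum integer $d$ such that, for some $d'$, there are $d$-local boxes $(B_v)_{v\in V(G)}$ in dimension $d'$ such that two distinct vertices $u,v$ are adjacent in $G$ if and only if $B_u\cap B_v\neq\emptyset$. *)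

theory Defs
  imports "HOL-Probability.Probability"
begin

text \<open>
  A graph is given by a vertex set \<open>V\<close> and a set \<open>E\<close> of two-element subsets of \<open>V\<close>.
\<close>

definition all_edges :: "'a set \<Rightarrow> 'a set set" where
  "all_edges V = {e. e \<subseteq> V \<and> card e = 2}"

text \<open>
  Bounded intervals may be open, closed or half-open, and may be single points; the empty set
  is not an interval. (The library predicate \<^const>\<open>is_interval\<close> also holds of the
  empty set and of half-lines.)
\<close>

definition real_interval :: "real set \<Rightarrow> bool" where
  "real_interval I \<longleftrightarrow> (is_interval I \<and> bounded I \<and> I \<noteq> {}) \<or> I = UNIV"

text \<open>
  A box in dimension \<open>d'\<close> is the product \<open>I 0 \<times> \<dots> \<times> I (d' - 1)\<close>, whose points are
  represented as extensional functions on \<open>{..<d'}\<close>.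
\<close>

definition local_box :: "nat \<Rightarrow> nat \<Rightarrow> (nat \<Rightarrow> real) set \<Rightarrow> bool" where
  "local_box d d' B \<longleftrightarrow>
     (\<exists>I. (\<forall>i<d'. real_interval (I i)) \<and> B = (\<Pi>\<^sub>E i\<in>{..<d'}. I i) \<and>
          card {i. i < d' \<and> bounded (I i)} \<le> d)"

definition has_local_box_rep :: "'a set \<Rightarrow> 'a set set \<Rightarrow> nat \<Rightarrow> bool" where
  "has_local_box_rep V E d \<longleftrightarrow>
     (\<exists>d'\<ge>1. d \<le> d' \<and>
       (\<exists>B. (\<forall>v\<in>V. local_box d d' (B v)) \<and>
            (\<forall>u\<in>V. \<forall>v\<in>V. u \<noteq> v \<longrightarrow> ({u, v} \<in> E \<longleftrightarrow> B u \<inter> B v \<noteq> {}))))"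

definition lbox :: "'a set \<Rightarrow> 'a set set \<Rightarrow> nat" where
  "lbox V E = (LEAST d. has_local_box_rep V E d)"

text \<open>The distribution of the edge set of the random graph on the vertex set \<open>{..<n}\<close>.\<close>

definition random_graph :: "nat \<Rightarrow> real \<Rightarrow> nat set set pmf" where
  "random_graph n p =
     map_pmf (\<lambda>X. {e \<in> all_edges {..<n}. X e})
       (Pi_pmf (all_edges {..<n}) False (\<lambda>_. bernoulli_pmf p))"

end

theory Submission
  imports Defs "HOL-Real_Asymp.Real_Asymp"
begin

text \<open>
  Upper bound. A graph of maximum degree \<open>\<Delta>\<close> has local boxicity at most \<open>8 \<Delta> + 6\<close>: take a proper
  colouring with \<open>\<Delta> + 1\<close> colours and a colouring \<open>\<psi>\<close> with \<open>\<Delta>\<^sup>2 + 1 \<le> 2 ^ (\<Delta> + 1)\<close> colours in which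
  vertices with a common neighbour differ, and in each class of the first colouring build the binary
  tree on the values of \<open>\<psi>\<close>, with two dimensions per node. A vertex \<open>u\<close> outside the class needs to
  be bounded only at the root and at the children of the nodes where the tree spanned by its
  neighbours branches, so it pays a constant per neighbour. In \<open>\<G>(n, p)\<close> the vertices of degree much
  larger than \<open>np\<close> are so few that every set \<open>S\<close> of them and their neighbours spans fewer than
  \<open>9/8 |S|\<close> edges; such a sparse graph splits into a forest and an independent set seen at most once
  by each vertex of the forest, hence has bounded local boxicity.

  Lower bound. Relabelling the dimensions and recording the relative order of the intervals shows
  that only \<open>(n d (n + 2)\<^sup>2) ^ (n d)\<close> graphs on \<open>n\<close> vertices have local boxicity at most \<open>d\<close>, while
  \<open>\<G>(n, p)\<close> has at least \<open>n\<^sup>2 p / 6\<close> edges, up to lower order terms, and equals any one such graph with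
  probability at most \<open>p ^ (n\<^sup>2 p / 6)\<close>.
\<close>

section \<open>Families of separating dimensions\<close>

text \<open>The degree bound alone gives O(np) only for np at least of order ln n: for constant np
  the maximum degree is unbounded, and the few vertices of high degree must be treated apart. A
  parameter d \<ge> np, at least a large constant, decides what is high: with high probability fewer
  than about n exp(-d) vertices have degree above 16 d, hence none once d \<ge> ln n. Within a
  colour class, lining up its members separates an outside vertex only from members beyond its
  outermost neighbours, and those in between force a subdivision. A tree over all members would have
  about ln n levels, and a member pays for every level; the values of \<psi> need only \<Delta> + 1
  levels, because it is enough to tell apart the neighbours of one vertex. In the lower bound each
  of the n d entries of a code costs at most a factor n^5, while each edge gains p \<le>
  n^(-\<epsilon>); with n np / 6 edges this balances at d = \<epsilon> np / 30, and 41 leaves room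
  for the lower order terms.\<close>

definition valid_dim :: "'a set \<Rightarrow> ('a \<Rightarrow> 'a \<Rightarrow> bool) \<Rightarrow> ('a \<Rightarrow> real set) \<Rightarrow> bool" where
  "valid_dim V adj f \<longleftrightarrow>
     (\<forall>v\<in>V. real_interval (f v)) \<and> (\<forall>u\<in>V. \<forall>v\<in>V. adj u v \<longrightarrow> f u \<inter> f v \<noteq> {})"

text \<open>An unbounded interval is free, so only bounded ones are counted. The budget
  \<open>k\<close> depends on the vertex because a vertex pays differently inside and outside its
  own colour class, and \<open>P\<close> is arbitrary so that pairs can be shared out among several
  families. With lists instead of sets, concatenation simply adds budgets.\<close>

definition separable ::
    "'a set \<Rightarrow> ('a \<Rightarrow> 'a \<Rightarrow> bool) \<Rightarrow> ('a \<Rightarrow> 'a \<Rightarrow> bool) \<Rightarrow> ('a \<Rightarrow> nat) \<Rightarrow> bool" where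
  "separable V adj P k \<longleftrightarrow>
     (\<exists>fs. (\<forall>f\<in>set fs. valid_dim V adj f) \<and>
           (\<forall>u\<in>V. \<forall>v\<in>V. P u v \<longrightarrow> (\<exists>f\<in>set fs. f u \<inter> f v = {})) \<and>
           (\<forall>v\<in>V. length (filter (\<lambda>f. bounded (f v)) fs) \<le> k v))"

lemma separable_family:
  assumes "finite F"
    and "\<And>i. i \<in> F \<Longrightarrow> valid_dim V adj (I i)"
    and "\<And>u v. u \<in> V \<Longrightarrow> v \<in> V \<Longrightarrow> P u v \<Longrightarrow> \<exists>i\<in>F. I i u \<inter> I i v = {}"
    and "\<And>v. v \<in> V \<Longrightarrow> card {i \<in> F. bounded (I i v)} \<le> k v"
  shows "separable V adj P k"
proof -
  obtain xs where xs: "set xs = F" "distinct xs"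
    using finite_distinct_list[OF assms(1)] by blast
  have "length (filter (\<lambda>f. bounded (f v)) (map I xs)) = card {i \<in> F. bounded (I i v)}" for v
  proof -
    have "length (filter (\<lambda>f. bounded (f v)) (map I xs)) = length (filter (\<lambda>i. bounded (I i v)) xs)"
      by (simp add: filter_map comp_def)
    also have "\<dots> = card (set (filter (\<lambda>i. bounded (I i v)) xs))"
      using distinct_card[OF distinct_filter[OF xs(2)]] by metis
    finally show ?thesis using xs by simp
  qed
  then show ?thesis
    unfolding separable_def using assms xs by (intro exI[of _ "map I xs"]) auto
qed

text \<open>Disjointness is symmetric, so it suffices that each pair is handled in one of its two
  orders; this lets a colour class take care only of pairs whose second vertex lies in it.\<close>

lemma separable_mono:
  assumes "separable V adj P k"
    and "\<And>u v. u \<in> V \<Longrightarrow> v \<in> V \<Longrightarrow> Q u v \<Longrightarrow> P u v \<or> P v u"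
    and "\<And>v. v \<in> V \<Longrightarrow> k v \<le> l v"
  shows "separable V adj Q l"
proof -
  obtain fs where fs: "\<forall>f\<in>set fs. valid_dim V adj f"
     "\<forall>u\<in>V. \<forall>v\<in>V. P u v \<longrightarrow> (\<exists>f\<in>set fs. f u \<inter> f v = {})"
     "\<forall>v\<in>V. length (filter (\<lambda>f. bounded (f v)) fs) \<le> k v"
    using assms(1) unfolding separable_def by blast
  have "\<exists>f\<in>set fs. f u \<inter> f v = {}" if "u \<in> V" "v \<in> V" "Q u v" for u v
    using assms(2)[OF that] fs(2) that(1,2) by (metis Int_commute)
  moreover have "length (filter (\<lambda>f. bounded (f v)) fs) \<le> l v" if "v \<in> V" for v
    using fs(3) assms(3)[OF that] that le_trans by blast
  ultimately show ?thesis
    unfolding separable_def using fs(1) by (intro exI[of _ fs]) simp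
qed

lemma separable_disj:
  assumes "separable V adj P k" "separable V adj Q l"
  shows "separable V adj (\<lambda>u v. P u v \<or> Q u v) (\<lambda>v. k v + l v)"
proof -
  obtain fs where fs: "\<forall>f\<in>set fs. valid_dim V adj f"
     "\<forall>u\<in>V. \<forall>v\<in>V. P u v \<longrightarrow> (\<exists>f\<in>set fs. f u \<inter> f v = {})"
     "\<forall>v\<in>V. length (filter (\<lambda>f. bounded (f v)) fs) \<le> k v"
    using assms(1) unfolding separable_def by blast
  obtain gs where gs: "\<forall>f\<in>set gs. valid_dim V adj f"
     "\<forall>u\<in>V. \<forall>v\<in>V. Q u v \<longrightarrow> (\<exists>f\<in>set gs. f u \<inter> f v = {})"
     "\<forall>v\<in>V. length (filter (\<lambda>f. bounded (f v)) gs) \<le> l v"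
    using assms(2) unfolding separable_def by blast
  have "\<forall>f\<in>set (fs @ gs). valid_dim V adj f" using fs(1) gs(1) by auto
  moreover have "\<forall>u\<in>V. \<forall>v\<in>V. P u v \<or> Q u v \<longrightarrow> (\<exists>f\<in>set (fs @ gs). f u \<inter> f v = {})"
    using fs(2) gs(2) by (metis Un_iff set_append)
  moreover have "\<forall>v\<in>V. length (filter (\<lambda>f. bounded (f v)) (fs @ gs)) \<le> k v + l v"
  proof
    fix v assume "v \<in> V"
    then show "length (filter (\<lambda>f. bounded (f v)) (fs @ gs)) \<le> k v + l v"
      unfolding filter_append length_append by (intro add_mono fs(3)[rule_format] gs(3)[rule_format])
  qed
  ultimately show ?thesis unfolding separable_def by (intro exI[of _ "fs @ gs"] conjI)
qed

lemma separable_sum: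
  fixes n :: nat
  assumes "\<And>i. i < n \<Longrightarrow> separable V adj (P i) (k i)"
  shows "separable V adj (\<lambda>u v. \<exists>i<n. P i u v) (\<lambda>v. \<Sum>i<n. k i v)"
  using assms
proof (induction n)
  case 0
  show ?case unfolding separable_def by (intro exI[of _ "[]"]) auto
next
  case (Suc n)
  have "separable V adj (\<lambda>u v. (\<exists>i<n. P i u v) \<or> P n u v) (\<lambda>v. (\<Sum>i<n. k i v) + k n v)"
    using Suc by (intro separable_disj) auto
  then show ?case
    by (rule separable_mono) (auto simp: less_Suc_eq)
qed

lemma real_interval_UNIV: "real_interval UNIV"
  by (simp add: real_interval_def)

lemma real_interval_Icc: "a \<le> b \<Longrightarrow> real_interval {a..b}"
  by (auto simp: real_interval_def is_interval_cc)

text \<open>Vertices outside \<open>Y\<close> receive the whole line, which is free and meets every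
  interval.\<close>

lemma separable_extend:
  assumes "separable Y adj P k" "Y \<subseteq> V"
  shows "separable V adj (\<lambda>u v. u \<in> Y \<and> v \<in> Y \<and> P u v) (\<lambda>v. if v \<in> Y then k v else 0)"
proof -
  obtain fs where fs: "\<forall>f\<in>set fs. valid_dim Y adj f"
     "\<forall>u\<in>Y. \<forall>v\<in>Y. P u v \<longrightarrow> (\<exists>f\<in>set fs. f u \<inter> f v = {})"
     "\<forall>v\<in>Y. length (filter (\<lambda>f. bounded (f v)) fs) \<le> k v"
    using assms(1) unfolding separable_def by blast
  define ext where "ext = (\<lambda>(f::'a \<Rightarrow> real set) v. if v \<in> Y then f v else UNIV)"
  have ne: "f v \<noteq> {}" if "valid_dim Y adj f" "v \<in> Y" for f v
    using that unfolding valid_dim_def real_interval_def by blast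
  have val: "valid_dim V adj (ext f)" if "f \<in> set fs" for f
    using that fs(1) ne[of f] unfolding valid_dim_def ext_def by (auto simp: real_interval_UNIV)
  have sep: "\<exists>g\<in>set (map ext fs). g u \<inter> g v = {}" if "u \<in> Y" "v \<in> Y" "P u v" for u v
    using fs(2) that by (auto simp: ext_def)
  have cost: "length (filter (\<lambda>f. bounded (f v)) (map ext fs)) \<le> (if v \<in> Y then k v else 0)" for v
    using fs(3) by (auto simp: filter_map comp_def ext_def)
  show ?thesis
    unfolding separable_def using val sep cost by (intro exI[of _ "map ext fs"]) auto
qed

lemma has_local_box_rep_if_separable:
  assumes "separable V (\<lambda>u v. {u, v} \<in> E) (\<lambda>u v. u \<noteq> v \<and> {u, v} \<notin> E) (\<lambda>_. k)"
  shows "has_local_box_rep V E k"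
proof -
  obtain fs where fs: "\<forall>f\<in>set fs. valid_dim V (\<lambda>u v. {u, v} \<in> E) f"
     "\<forall>u\<in>V. \<forall>v\<in>V. u \<noteq> v \<and> {u, v} \<notin> E \<longrightarrow> (\<exists>f\<in>set fs. f u \<inter> f v = {})"
     "\<forall>v\<in>V. length (filter (\<lambda>f. bounded (f v)) fs) \<le> k"
    using assms(1) unfolding separable_def by blast
  \<comment> \<open>The summand \<open>k + 1\<close> pads with coordinates equal to the whole line,
    because a representation must satisfy \<open>1 \<le> d'\<close> and \<open>k \<le> d'\<close>
    even if few dimensions separate anything.\<close>
  define d' where "d' = length fs + k + 1"
  define I where "I = (\<lambda>v i. if i < length fs then (fs ! i) v else UNIV)"
  define B where "B = (\<lambda>v. \<Pi>\<^sub>E i\<in>{..<d'}. I v i)"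
  have "local_box k d' (B v)" if v: "v \<in> V" for v
  proof -
    have "\<forall>i<d'. real_interval (I v i)"
      using fs(1) v by (auto simp: I_def real_interval_UNIV valid_dim_def)
    moreover have "{i. i < d' \<and> bounded (I v i)} = {i. i < length fs \<and> bounded ((fs ! i) v)}"
      by (auto simp: I_def d'_def)
    then have "card {i. i < d' \<and> bounded (I v i)} = length (filter (\<lambda>f. bounded (f v)) fs)"
      by (simp add: length_filter_conv_card)
    ultimately show ?thesis
      unfolding local_box_def B_def using fs(3) v by (intro exI[of _ "I v"]) auto
  qed
  moreover have "{u, v} \<in> E \<longleftrightarrow> B u \<inter> B v \<noteq> {}" if uv: "u \<in> V" "v \<in> V" "u \<noteq> v" for u v
  proof -
    have "B u \<inter> B v \<noteq> {} \<longleftrightarrow> (\<forall>i<d'. I u i \<inter> I v i \<noteq> {})"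
      unfolding B_def by (auto simp: PiE_Int PiE_eq_empty_iff)
    also have "\<dots> \<longleftrightarrow> (\<forall>f\<in>set fs. f u \<inter> f v \<noteq> {})"
      by (auto simp: I_def d'_def all_set_conv_all_nth)
    also have "\<dots> \<longleftrightarrow> {u, v} \<in> E"
    proof
      assume "\<forall>f\<in>set fs. f u \<inter> f v \<noteq> {}"
      then show "{u, v} \<in> E" using fs(2) uv by metis
    next
      assume "{u, v} \<in> E"
      then show "\<forall>f\<in>set fs. f u \<inter> f v \<noteq> {}"
        using fs(1) uv(1,2) by (simp add: valid_dim_def)
    qed
    finally show ?thesis by blast
  qed
  ultimately show ?thesis
    unfolding has_local_box_rep_def by (intro exI[of _ d'] conjI exI[of _ B]) (auto simp: d'_def)
qed

text \<open>
  All intervals outside \<open>c\<close> contain \<open>0\<close>, so that edges between vertices outside \<open>c\<close> do no harm.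
\<close>

definition chain_dim :: "('a \<Rightarrow> 'a \<Rightarrow> bool) \<Rightarrow> 'a set \<Rightarrow> 'a set \<Rightarrow> ('a \<Rightarrow> nat) \<Rightarrow> 'a \<Rightarrow> real set" where
  "chain_dim adj c U pos v =
     (if v \<in> c then {real (pos v)}
      else if v \<in> U then {0..real (Max (insert 0 (pos ` {y \<in> c. adj v y})))}
      else UNIV)"

lemma valid_chain_dim:
  assumes "finite c" and sym: "\<And>u v. adj u v \<Longrightarrow> adj v u"
    and "\<And>x y. x \<in> c \<Longrightarrow> y \<in> c \<Longrightarrow> \<not> adj x y"
  shows "valid_dim V adj (chain_dim adj c U pos)"
proof -
  have 1: "real_interval (chain_dim adj c U pos v)" for v
    using assms(1) real_interval_Icc[of "real (pos v)" "real (pos v)"]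
    by (auto simp: chain_dim_def real_interval_UNIV intro!: real_interval_Icc)
  have fin: "finite (insert 0 (pos ` {y \<in> c. adj u y}))" for u using assms(1) by simp
  have 2: "real (pos v) \<in> chain_dim adj c U pos u" if "adj u v" "v \<in> c" for u v
  proof -
    have "pos v \<le> Max (insert 0 (pos ` {y \<in> c. adj u y}))"
      using that by (intro Max_ge[OF fin]) auto
    then show ?thesis
      using assms(3) that by (auto simp: chain_dim_def)
  qed
  have 3: "0 \<in> chain_dim adj c U pos u" if "u \<notin> c" for u
    using that by (auto simp: chain_dim_def)
  have "chain_dim adj c U pos u \<inter> chain_dim adj c U pos v \<noteq> {}" if "adj u v" for u v
  proof (cases "u \<in> c \<or> v \<in> c")
    case True
    have "real (pos w) \<in> chain_dim adj c U pos w" if "w \<in> c" for w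
      using that by (simp add: chain_dim_def)
    then show ?thesis using 2 True that sym by blast
  next
    case False
    then show ?thesis using 3 by blast
  qed
  then show ?thesis using 1 by (auto simp: valid_dim_def)
qed

lemma bounded_chain_dim: "bounded (chain_dim adj c U pos v) \<longleftrightarrow> v \<in> c \<or> v \<in> U"
  by (auto simp: chain_dim_def)

lemma chain_dim_disjoint_class:
  "x \<in> c \<Longrightarrow> y \<in> c \<Longrightarrow> pos x \<noteq> pos y \<Longrightarrow> chain_dim adj c U pos x \<inter> chain_dim adj c U pos y = {}"
  by (auto simp: chain_dim_def)

text \<open>A vertex outside \<open>c\<close> is stretched from 0 to its last neighbour in
  \<open>c\<close>, so it misses everything beyond. Reversing the order disposes of the members
  before its first neighbour.\<close>

lemma chain_dim_disjoint:
  assumes "finite c" "u \<in> U" "u \<notin> c" "y \<in> c" "0 < pos y"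
    and "\<And>x. x \<in> c \<Longrightarrow> adj u x \<Longrightarrow> pos x < pos y"
  shows "chain_dim adj c U pos u \<inter> chain_dim adj c U pos y = {}"
proof -
  define m where "m = Max (insert 0 (pos ` {y \<in> c. adj u y}))"
  have "m < pos y"
    unfolding m_def using assms by (subst Max_less_iff) auto
  moreover have "chain_dim adj c U pos u = {0..real m}" "chain_dim adj c U pos y = {real (pos y)}"
    using assms(2-4) by (simp_all add: chain_dim_def m_def)
  ultimately show ?thesis by simp
qed

text \<open>Halving is injective apart from gluing \<open>2 * r\<close> to \<open>2 * r + 1\<close>,
  hence it loses one element per pair that lies wholly in \<open>S\<close>. In the proof this is
  inclusion-exclusion for \<open>E\<close> and \<open>O'\<close>.\<close>

lemma card_eq_card_halves:
  fixes S :: "nat set"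
  assumes "finite S"
  shows "card S = card ((\<lambda>x. x div 2) ` S) + card {r. 2 * r \<in> S \<and> 2 * r + 1 \<in> S}"
proof -
  define E O' where "E = {r. 2 * r \<in> S}" and "O' = {r. 2 * r + 1 \<in> S}"
  have finE: "finite E" "finite O'"
    using finite_vimageI[OF assms, of "\<lambda>r. 2 * r"] finite_vimageI[OF assms, of "\<lambda>r. 2 * r + 1"]
    by (auto simp: E_def O'_def vimage_def inj_def)
  have S: "S = (\<lambda>r. 2 * r) ` E \<union> (\<lambda>r. 2 * r + 1) ` O'"
  proof (intro set_eqI iffI)
    fix x assume "x \<in> S"
    then show "x \<in> (\<lambda>r. 2 * r) ` E \<union> (\<lambda>r. 2 * r + 1) ` O'"
      by (cases "even x") (auto simp: E_def O'_def elim!: evenE oddE)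
  qed (auto simp: E_def O'_def)
  have disj: "(\<lambda>r. 2 * r) ` E \<inter> (\<lambda>r. 2 * r + 1) ` O' = {}"
    by auto presburger
  have "card S = card E + card O'"
    using finE disj by (subst S, subst card_Un_disjoint) (auto simp: card_image inj_on_def)
  also have "\<dots> = card (E \<union> O') + card (E \<inter> O')"
    using card_Un_Int[OF finE] .
  also have "E \<union> O' = (\<lambda>x. x div 2) ` S"
    by (subst S) (auto simp: image_Un image_image)
  also have "E \<inter> O' = {r. 2 * r \<in> S \<and> 2 * r + 1 \<in> S}"
    by (auto simp: E_def O'_def)
  finally show ?thesis .
qed

section \<open>Graphs of bounded degree\<close>

text \<open>
  The number of nodes at height \<open>j\<close> hit by \<open>A\<close> drops, from \<open>j\<close> to \<open>j + 1\<close>, by the number of branching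
  nodes, so that the sum telescopes.
\<close>

lemma card_branching_le:
  fixes f :: "'a \<Rightarrow> nat"
  assumes "finite A"
  shows "(\<Sum>j<L. card {r. 2 * r \<in> (\<lambda>y. f y div 2 ^ j) ` A \<and> 2 * r + 1 \<in> (\<lambda>y. f y div 2 ^ j) ` A})
           \<le> card A"
proof -
  define S where "S = (\<lambda>j. (\<lambda>y. f y div 2 ^ j) ` A)"
  have half: "(\<lambda>x. x div 2) ` S j = S (Suc j)" for j
    unfolding S_def image_image by (intro image_cong) (simp_all add: div_mult2_eq[symmetric] mult.commute)
  have fin: "finite (S j)" for j
    using assms by (simp add: S_def)
  have "(\<Sum>j<L. card {r. 2 * r \<in> S j \<and> 2 * r + 1 \<in> S j}) + card (S L) = card (S 0)"
  proof (induction L)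
    case (Suc L)
    show ?case
      using Suc card_eq_card_halves[OF fin[of L]] unfolding half by simp
  qed simp
  moreover have "card (S 0) \<le> card A"
    unfolding S_def using assms by (rule card_image_le)
  ultimately show ?thesis
    unfolding S_def by linarith
qed

lemma finite_halves: "finite S \<Longrightarrow> finite {r. 2 * r \<in> S \<and> 2 * r + 1 \<in> (S :: nat set)}"
  by (rule finite_subset[of _ "(\<lambda>x. x div 2) ` S"]) (auto intro!: image_eqI)

text \<open>Positions refine the order of \<open>\<phi>\<close>, so every tree node is convex in the
  order of positions. They are positive because intervals outside the class contain 0, and the bound
  \<open>M\<close> makes the reversed positions \<open>M - pos x\<close> positive as well.\<close>

lemma refining_enumeration:
  fixes \<phi> :: "'a \<Rightarrow> nat"
  assumes "finite c"
  obtains pos :: "'a \<Rightarrow> nat" and M :: nat where "inj_on pos c"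
    "\<And>x. x \<in> c \<Longrightarrow> 0 < pos x \<and> pos x < M"
    "\<And>x y. x \<in> c \<Longrightarrow> y \<in> c \<Longrightarrow> pos x \<le> pos y \<Longrightarrow> \<phi> x \<le> \<phi> y"
proof -
  obtain idx where idx: "bij_betw idx c {0..<card c}"
    using ex_bij_betw_finite_nat[OF assms] by blast
  define N where "N = card c + 1"
  \<comment> \<open>Lexicographic by \<open>\<phi>\<close> and then the index: as every index is
    below \<open>N\<close>, division by \<open>N\<close> recovers \<open>\<phi>\<close>.\<close>
  define pos where "pos = (\<lambda>x. \<phi> x * N + idx x + 1)"
  have lt: "idx x < N" if "x \<in> c" for x
    using bij_betwE[OF idx] that by (fastforce simp: N_def)
  have ord: "\<phi> x \<le> \<phi> y" if "x \<in> c" "y \<in> c" "pos x \<le> pos y" for x y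
  proof -
    have "(\<phi> x * N + idx x) div N \<le> (\<phi> y * N + idx y) div N"
      using that(3) by (intro div_le_mono) (simp add: pos_def)
    then show ?thesis using lt[OF that(1)] lt[OF that(2)] by simp
  qed
  have "inj_on pos c"
  proof (rule inj_onI)
    fix x y assume xy: "x \<in> c" "y \<in> c" "pos x = pos y"
    then have "\<phi> x = \<phi> y" using ord[of x y] ord[of y x] by simp
    then have "idx x = idx y" using xy by (simp add: pos_def)
    then show "x = y" using idx xy by (meson bij_betw_imp_inj_on inj_onD)
  qed
  moreover have "0 < pos x \<and> pos x < Suc (Max (pos ` c))" if "x \<in> c" for x
    using assms that by (simp add: pos_def less_Suc_eq_le)
  ultimately show ?thesis using ord that by metis
qed

text \<open>Each tree node carries the chain of its members in both directions. If both directions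
  fail to separate \<open>u\<close> from \<open>y\<close> at a node where \<open>u\<close> is
  bounded, neighbours of \<open>u\<close> inside the node lie on both sides of \<open>y\<close>; at
  the leaf this contradicts injectivity of \<open>\<phi>\<close>. A member of \<open>c\<close> is
  bounded twice at each of the \<open>L + 1\<close> nodes containing it; an outside vertex at the
  root and at the two children of each branching node, and it has no more branching nodes than
  neighbours.\<close>

lemma separable_class:
  assumes fin: "finite V" and "c \<subseteq> V"
    and sym: "\<And>u v. adj u v \<Longrightarrow> adj v u"
    and indep: "\<And>x y. x \<in> c \<Longrightarrow> y \<in> c \<Longrightarrow> \<not> adj x y"
    and lt: "\<And>x. x \<in> c \<Longrightarrow> \<phi> x < (2::nat) ^ L"
    and inj: "\<And>u. u \<in> V - c \<Longrightarrow> inj_on \<phi> {y \<in> c. adj u y}"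
  shows "separable V adj (\<lambda>u v. v \<in> c \<and> u \<noteq> v \<and> \<not> adj u v)
           (\<lambda>v. if v \<in> c then 2 * (L + 1) else 2 + 4 * card {y \<in> c. adj v y})"
proof -
  have finc: "finite c" using assms(2) fin finite_subset by blast
  obtain pos :: "'a \<Rightarrow> nat" and M where pos: "inj_on pos c"
    "\<And>x. x \<in> c \<Longrightarrow> 0 < pos x \<and> pos x < M"
    "\<And>x y. x \<in> c \<Longrightarrow> y \<in> c \<Longrightarrow> pos x \<le> pos y \<Longrightarrow> \<phi> x \<le> \<phi> y"
    using refining_enumeration[OF finc, of \<phi>] by blast
  define S where "S = (\<lambda>u j. (\<lambda>y. \<phi> y div 2 ^ j) ` {y \<in> c. adj u y})"
  define Br where "Br = (\<lambda>u j. {r. 2 * r \<in> S u j \<and> 2 * r + 1 \<in> S u j})"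
  define node where "node = (\<lambda>j q. {y \<in> c. \<phi> y div 2 ^ j = q})"
  \<comment> \<open>\<open>Br u j\<close> consists of nodes of height \<open>j + 1\<close>, named by
    the index \<open>r\<close> whose children are \<open>2 * r\<close> and \<open>2 * r + 1\<close>;
    hence the test on the parent \<open>q div 2\<close>. Height \<open>L\<close> is the
    root.\<close>
  define U where "U = (\<lambda>j q. {u \<in> V - c. j = L \<or> q div 2 \<in> Br u j})"
  define ps where "ps = (\<lambda>(s::bool) x. if s then pos x else M - pos x)"
  define I where "I = (\<lambda>(s, j, q). chain_dim adj (node j q) (U j q) (ps s))"
  define F where "F = (UNIV :: bool set) \<times> (SIGMA j:{..L}. {..<(2::nat) ^ (L - j)})"
  have lt_div: "\<phi> x div 2 ^ j < 2 ^ (L - j)" if "x \<in> c" "j \<le> L" for x j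
    using lt[OF that(1)] that(2) by (intro less_mult_imp_div_less) (simp add: power_add[symmetric])
  have finn: "finite (node j q)" for j q using finc by (simp add: node_def)
  have node_sub: "node j q \<subseteq> c" for j q by (auto simp: node_def)
  show ?thesis
  proof (rule separable_family[of F _ _ I])
    show "finite F" by (simp add: F_def)
  next
    fix i assume "i \<in> F"
    obtain s j q where i: "i = (s, j, q)" by (cases i)
    show "valid_dim V adj (I i)"
      unfolding I_def i prod.case
      by (rule valid_chain_dim) (use finn sym indep node_sub in blast)+
  next
    fix u y assume uy: "u \<in> V" "y \<in> V" "y \<in> c \<and> u \<noteq> y \<and> \<not> adj u y"
    show "\<exists>i\<in>F. I i u \<inter> I i y = {}"
    proof (cases "u \<in> c")
      case True
      have "\<phi> u div 2 ^ L = 0" "\<phi> y div 2 ^ L = 0" using lt True uy by simp_all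
      moreover have "pos u \<noteq> pos y" using pos(1) True uy by (meson inj_onD)
      ultimately have "I (True, L, 0) u \<inter> I (True, L, 0) y = {}"
        using True uy unfolding I_def prod.case
        by (intro chain_dim_disjoint_class) (auto simp: node_def ps_def)
      then show ?thesis by (intro bexI[of _ "(True, L, 0)"]) (auto simp: F_def)
    next
      case False
      show ?thesis
      proof (rule ccontr)
        assume neg: "\<not> (\<exists>i\<in>F. I i u \<inter> I i y = {})"
        define qq where "qq = (\<lambda>j. \<phi> y div 2 ^ j)"
        have F_mem: "(s, j, qq j) \<in> F" if "j \<le> L" for s j
          using that lt_div uy by (auto simp: F_def qq_def)
        have y_mem: "y \<in> node j (qq j)" for j using uy by (simp add: node_def qq_def)
        have squeeze: "\<exists>x x'. x \<in> node j (qq j) \<and> x' \<in> node j (qq j) \<and> adj u x \<and> adj u x' \<and>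
            pos x < pos y \<and> pos y < pos x'" if j: "j \<le> L" and bd: "u \<in> U j (qq j)" for j
        proof -
          have ex: "\<exists>x. x \<in> node j (qq j) \<and> adj u x \<and> \<not> ps s x < ps s y" for s
          proof (rule ccontr)
            assume "\<nexists>x. x \<in> node j (qq j) \<and> adj u x \<and> \<not> ps s x < ps s y"
            then have "chain_dim adj (node j (qq j)) (U j (qq j)) (ps s) u \<inter>
                   chain_dim adj (node j (qq j)) (U j (qq j)) (ps s) y = {}"
              using finn bd y_mem False uy pos(2)[of y]
              by (intro chain_dim_disjoint) (auto simp: node_def ps_def)
            then show False using neg F_mem[OF j, of s] unfolding I_def by force
          qed
          obtain x where x: "x \<in> node j (qq j)" "adj u x" "\<not> ps False x < ps False y"
            using ex by blast
          obtain x' where x': "x' \<in> node j (qq j)" "adj u x'" "\<not> ps True x' < ps True y"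
            using ex by blast
          have c: "x \<in> c" "x' \<in> c" "y \<in> c" using x x' uy by (auto simp: node_def)
          have "x \<noteq> y" "x' \<noteq> y" using x(2) x'(2) uy by auto
          then have "pos x \<noteq> pos y" "pos x' \<noteq> pos y"
            using pos(1) c by (meson inj_onD)+
          then have "pos x < pos y" "pos y < pos x'"
            using x(3) x'(3) pos(2)[OF c(1)] pos(2)[OF c(3)] by (auto simp: ps_def)
          then show ?thesis using x x' by blast
        qed
        \<comment> \<open>Down to the leaf of \<open>y\<close>, neighbours of \<open>u\<close> lie on both sides of \<open>y\<close>: either the two
          found so far fall into the same child, or the node branches and \<open>u\<close> is bounded there.\<close>
        have "\<exists>x x'. x \<in> node j (qq j) \<and> x' \<in> node j (qq j) \<and> adj u x \<and> adj u x' \<and>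
            pos x < pos y \<and> pos y < pos x'" if "j \<le> L" for j
          using that
        proof (induction j rule: inc_induct)
          case base
          show ?case using False uy by (intro squeeze) (auto simp: U_def)
        next
          case (step j)
          then obtain x x' where x: "x \<in> node (Suc j) (qq (Suc j))" "x' \<in> node (Suc j) (qq (Suc j))"
            "adj u x" "adj u x'" "pos x < pos y" "pos y < pos x'" by blast
          have c: "x \<in> c" "x' \<in> c" "y \<in> c" using x uy by (auto simp: node_def)
          have "\<phi> x \<le> \<phi> y" "\<phi> y \<le> \<phi> x'" using pos(3) c x by auto
          then have le: "\<phi> x div 2 ^ j \<le> qq j" "qq j \<le> \<phi> x' div 2 ^ j"
            by (auto simp: qq_def div_le_mono)
          have par: "\<phi> x div 2 ^ j div 2 = qq j div 2" "\<phi> x' div 2 ^ j div 2 = qq j div 2"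
            using x(1,2) by (simp_all add: node_def qq_def div_mult2_eq[symmetric] mult.commute)
          show ?case
          proof (cases "\<phi> x div 2 ^ j = \<phi> x' div 2 ^ j")
            case True
            then have "x \<in> node j (qq j)" "x' \<in> node j (qq j)" using le c by (auto simp: node_def)
            then show ?thesis using x by blast
          next
            case ne: False
            then have "\<phi> x div 2 ^ j < \<phi> x' div 2 ^ j" using le by simp
            then have ends: "\<phi> x div 2 ^ j = 2 * (qq j div 2)" "\<phi> x' div 2 ^ j = 2 * (qq j div 2) + 1"
              using par by linarith+
            have "\<phi> x div 2 ^ j \<in> S u j" "\<phi> x' div 2 ^ j \<in> S u j"
              using c x by (auto simp: S_def)
            then have "qq j div 2 \<in> Br u j"
              unfolding ends by (simp add: Br_def)
            then show ?thesis
              using step False uy by (intro squeeze) (auto simp: U_def)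
          qed
        qed
        from this[of 0] obtain x x' where x: "x \<in> c" "x' \<in> c" "\<phi> x = \<phi> x'" "adj u x" "adj u x'"
            "pos x < pos y" "pos y < pos x'"
          by (auto simp: node_def qq_def)
        then show False using inj[of u] False uy by (auto dest!: inj_onD[of _ _ x x'])
      qed
    qed
  next
    fix v assume v: "v \<in> V"
    have bd: "bounded (I (s, j, q) v) \<longleftrightarrow> v \<in> node j q \<or> v \<in> U j q" for s j q
      by (simp add: I_def bounded_chain_dim)
    show "card {i \<in> F. bounded (I i v)} \<le>
       (if v \<in> c then 2 * (L + 1) else 2 + 4 * card {y \<in> c. adj v y})"
    proof (cases "v \<in> c")
      case True
      have "{i \<in> F. bounded (I i v)} \<subseteq> (\<lambda>(s, j). (s, j, \<phi> v div 2 ^ j)) ` (UNIV \<times> {..L})"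
        using True by (auto simp: F_def bd node_def U_def image_iff)
      then have "card {i \<in> F. bounded (I i v)} \<le> card ((\<lambda>(s::bool, j). (s, j, \<phi> v div 2 ^ j)) ` (UNIV \<times> {..L}))"
        by (intro card_mono) auto
      also have "\<dots> \<le> card ((UNIV :: bool set) \<times> {..L})"
        by (rule card_image_le) simp
      finally show ?thesis using True by (simp add: card_cartesian_product)
    next
      case False
      have finN: "finite {y \<in> c. adj v y}" using finc by simp
      have finB: "finite (Br v j)" for j
        unfolding Br_def using finN by (intro finite_halves) (simp add: S_def)
      define T where "T = (SIGMA j:{..<L}. Br v j)"
      \<comment> \<open>\<open>s\<close> is the direction and \<open>b\<close> tells the right child
        of the branching node \<open>r\<close> from the left one; the factor 4 below counts these
        choices.\<close>
      define g where "g = (\<lambda>(s::bool, b::bool, j::nat, r::nat). (s, j, 2 * r + (if b then 1 else 0)))"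
      have "{i \<in> F. bounded (I i v)} \<subseteq> (\<lambda>s. (s, L, 0)) ` UNIV \<union> g ` (UNIV \<times> UNIV \<times> T)"
      proof
        fix i assume "i \<in> {i \<in> F. bounded (I i v)}"
        then obtain s j q where i: "i = (s, j, q)" "j \<le> L" "q < 2 ^ (L - j)" "v \<in> U j q"
          using False by (auto simp: F_def bd node_def)
        show "i \<in> (\<lambda>s. (s, L, 0)) ` UNIV \<union> g ` (UNIV \<times> UNIV \<times> T)"
        proof (cases "j = L")
          case True
          then show ?thesis using i by simp
        next
          case False
          then have "i = g (s, odd q, j, q div 2)" "(j, q div 2) \<in> T"
            using i by (auto simp: g_def T_def U_def)
          then show ?thesis by blast
        qed
      qed
      then have "card {i \<in> F. bounded (I i v)} \<le>
          card ((\<lambda>s::bool. (s, L, 0::nat)) ` UNIV \<union> g ` (UNIV \<times> UNIV \<times> T))"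
        using finB by (intro card_mono) (auto simp: T_def)
      also have "\<dots> \<le> card ((\<lambda>s::bool. (s, L, 0::nat)) ` UNIV) + card (g ` (UNIV \<times> UNIV \<times> T))"
        by (rule card_Un_le)
      also have "\<dots> \<le> card (UNIV :: bool set) + card ((UNIV :: bool set) \<times> (UNIV :: bool set) \<times> T)"
        using finB by (intro add_mono card_image_le) (auto simp: T_def)
      also have "\<dots> = 2 + 4 * (\<Sum>j<L. card (Br v j))"
        using finB by (simp add: card_cartesian_product T_def)
      also have "\<dots> \<le> 2 + 4 * card {y \<in> c. adj v y}"
        using card_branching_le[OF finN, where L = L and f = \<phi>] by (simp add: Br_def S_def)
      finally show ?thesis using False by simp
    qed
  qed
qed

text \<open>Stated for an arbitrary relation because it is applied both to adjacency and to having a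
  common neighbour.\<close>

lemma greedy_coloring:
  assumes "finite V"
    and sym: "\<And>u v. R u v \<Longrightarrow> R v u" and irr: "\<And>v. \<not> R v v"
    and "\<And>v. v \<in> V \<Longrightarrow> card {u \<in> V. R v u} \<le> D"
  obtains f :: "'a \<Rightarrow> nat" where "\<And>v. v \<in> V \<Longrightarrow> f v \<le> D"
    "\<And>u v. u \<in> V \<Longrightarrow> v \<in> V \<Longrightarrow> R u v \<Longrightarrow> f u \<noteq> f v"
proof -
  have "\<exists>f :: 'a \<Rightarrow> nat. (\<forall>v\<in>V. f v \<le> D) \<and> (\<forall>u\<in>V. \<forall>v\<in>V. R u v \<longrightarrow> f u \<noteq> f v)"
    using assms(1,4)
  proof (induction V)
    case (insert x V)
    have "card {u \<in> V. R v u} \<le> D" if "v \<in> V" for v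
    proof -
      have "card {u \<in> V. R v u} \<le> card {u \<in> insert x V. R v u}"
        using insert.hyps(1) by (intro card_mono) auto
      also have "\<dots> \<le> D" using insert.prems that by blast
      finally show ?thesis .
    qed
    then obtain f :: "'a \<Rightarrow> nat" where f: "\<forall>v\<in>V. f v \<le> D" "\<forall>u\<in>V. \<forall>v\<in>V. R u v \<longrightarrow> f u \<noteq> f v"
      using insert.IH by blast
    have "card (f ` {u \<in> V. R x u}) \<le> card {u \<in> V. R x u}"
      using insert.hyps(1) by (intro card_image_le) simp
    also have "\<dots> \<le> card {u \<in> insert x V. R x u}"
      using insert.hyps(1) by (intro card_mono) auto
    also have "\<dots> \<le> D" using insert.prems by blast
    also have "\<dots> < card {..D}" by simp
    finally have "\<exists>k\<in>{..D}. k \<notin> f ` {u \<in> V. R x u}"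
      using insert.hyps(1) card_mono[of "f ` {u \<in> V. R x u}" "{..D}"] by fastforce
    then obtain k where k: "k \<le> D" "k \<notin> f ` {u \<in> V. R x u}" by auto
    have "(f(x := k)) u \<noteq> (f(x := k)) v" if "u \<in> insert x V" "v \<in> insert x V" "R u v" for u v
      using that f(2) k(2) sym[OF that(3)] irr[of u] insert.hyps(2) by (auto simp: image_iff)
    moreover have "(f(x := k)) v \<le> D" if "v \<in> insert x V" for v
      using that f(1) k(1) by auto
    ultimately show ?case by blast
  qed simp
  then show ?thesis using that by blast
qed

text \<open>Neighbours of \<open>u\<close> within a class have \<open>u\<close> as a common
  neighbour, so \<open>\<psi>\<close> is injective on them and \<open>separable_class\<close>
  applies with \<open>L = D + 1\<close>. A vertex pays \<open>2 * (D + 2)\<close> in its own class,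
  and over all \<open>D + 1\<close> classes at most 2 each plus 4 per neighbour, which adds up to
  \<open>8 * D + 6\<close>.\<close>

lemma separable_max_degree:
  assumes fin: "finite V"
    and sym: "\<And>u v. adj u v \<Longrightarrow> adj v u" and irr: "\<And>v. \<not> adj v v"
    and deg: "\<And>v. v \<in> V \<Longrightarrow> card {u \<in> V. adj v u} \<le> D"
  shows "separable V adj (\<lambda>u v. u \<noteq> v \<and> \<not> adj u v) (\<lambda>_. 8 * D + 6)"
proof -
  obtain \<kappa> :: "'a \<Rightarrow> nat" where \<kappa>: "\<And>v. v \<in> V \<Longrightarrow> \<kappa> v \<le> D"
      "\<And>u v. u \<in> V \<Longrightarrow> v \<in> V \<Longrightarrow> adj u v \<Longrightarrow> \<kappa> u \<noteq> \<kappa> v"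
    using greedy_coloring[of V adj D] fin sym irr deg by blast
  define R where "R = (\<lambda>u v. u \<noteq> v \<and> (\<exists>w\<in>V. adj u w \<and> adj w v))"
  have cardR: "card {u \<in> V. R v u} \<le> D * D" if "v \<in> V" for v
  proof -
    have "{u \<in> V. R v u} \<subseteq> (\<Union>w\<in>{w \<in> V. adj v w}. {u \<in> V. adj w u})"
      by (auto simp: R_def)
    then have "card {u \<in> V. R v u} \<le> card (\<Union>w\<in>{w \<in> V. adj v w}. {u \<in> V. adj w u})"
      using fin by (intro card_mono) auto
    also have "\<dots> \<le> (\<Sum>w\<in>{w \<in> V. adj v w}. card {u \<in> V. adj w u})"
      using fin by (intro card_UN_le) auto
    also have "\<dots> \<le> of_nat (card {w \<in> V. adj v w}) * D"
      using deg by (intro sum_bounded_above) auto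
    also have "\<dots> \<le> D * D" using deg[OF that] by simp
    finally show ?thesis .
  qed
  have symR: "R v u" if "R u v" for u v
    using that sym unfolding R_def by blast
  have irrR: "\<not> R v v" for v by (simp add: R_def)
  obtain \<psi> :: "'a \<Rightarrow> nat" where \<psi>: "\<And>v. v \<in> V \<Longrightarrow> \<psi> v \<le> D * D"
      "\<And>u v. u \<in> V \<Longrightarrow> v \<in> V \<Longrightarrow> R u v \<Longrightarrow> \<psi> u \<noteq> \<psi> v"
    using greedy_coloring[of V R "D * D", OF fin symR irrR cardR] by blast
  \<comment> \<open>The second conjunct strengthens the induction: \<open>2 * D + 1\<close> is the
    difference of consecutive squares.\<close>
  have pow: "D * D < 2 ^ (D + 1) \<and> 2 * D + 1 \<le> (2::nat) ^ (D + 1)"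
  proof (induction D)
    case (Suc D)
    define X where "X = (2::nat) ^ D"
    have "1 \<le> X" "D * D < 2 * X" "2 * D + 1 \<le> 2 * X"
      using Suc by (simp_all add: X_def)
    then have "Suc D * Suc D < 4 * X" "2 * Suc D + 1 \<le> 4 * X"
      by (simp_all, linarith)
    then show ?case by (simp add: X_def)
  qed simp
  define c where "c = (\<lambda>i. {v \<in> V. \<kappa> v = i})"
  define k where "k = (\<lambda>i v. if v \<in> c i then 2 * (D + 1 + 1) else 2 + 4 * card {y \<in> c i. adj v y})"
  have "separable V adj (\<lambda>u v. v \<in> c i \<and> u \<noteq> v \<and> \<not> adj u v) (k i)" for i
    unfolding k_def
  proof (rule separable_class[where \<phi> = \<psi>])
    fix u assume u: "u \<in> V - c i"
    show "inj_on \<psi> {y \<in> c i. adj u y}"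
    proof (rule inj_onI, rule ccontr)
      fix x y assume xy: "x \<in> {y \<in> c i. adj u y}" "y \<in> {y \<in> c i. adj u y}" "\<psi> x = \<psi> y" "x \<noteq> y"
      then have "R x y" using u sym unfolding R_def c_def by blast
      then show False using xy \<psi>(2) by (auto simp: c_def)
    qed
  next
    fix x y assume "x \<in> c i" "y \<in> c i"
    then show "\<not> adj x y" using \<kappa>(2)[of x y] by (auto simp: c_def)
  next
    fix x assume "x \<in> c i"
    then show "\<psi> x < 2 ^ (D + 1)" using \<psi>(1) pow by (auto simp: c_def intro: le_less_trans)
  qed (use fin sym in \<open>auto simp: c_def\<close>)
  then have "separable V adj (\<lambda>u v. \<exists>i<D+1. v \<in> c i \<and> u \<noteq> v \<and> \<not> adj u v) (\<lambda>v. \<Sum>i<D+1. k i v)"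
    by (intro separable_sum)
  then show ?thesis
  proof (rule separable_mono)
    fix u v assume "u \<in> V" "v \<in> V" "u \<noteq> v \<and> \<not> adj u v"
    then show "(\<exists>i<D + 1. v \<in> c i \<and> u \<noteq> v \<and> \<not> adj u v) \<or> (\<exists>i<D + 1. u \<in> c i \<and> v \<noteq> u \<and> \<not> adj v u)"
      using \<kappa>(1)[of v] by (auto simp: c_def less_Suc_eq_le)
  next
    fix v assume v: "v \<in> V"
    have "(\<Sum>i<D+1. k i v) \<le> (\<Sum>i<D+1. (if i = \<kappa> v then 2 * (D + 2) else 0) + (2 + 4 * card {y \<in> c i. adj v y}))"
      using v by (intro sum_mono) (auto simp: k_def c_def)
    also have "\<dots> = 2 * (D + 2) + 2 * (D + 1) + 4 * (\<Sum>i<D+1. card {y \<in> c i. adj v y})"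
      unfolding sum.distrib sum_distrib_left[symmetric]
      using \<kappa>(1)[OF v] by (simp add: sum.delta' del: sum.lessThan_Suc)
    finally have sum: "(\<Sum>i<D+1. k i v) \<le> 2 * (D + 2) + 2 * (D + 1) + 4 * (\<Sum>i<D+1. card {y \<in> c i. adj v y})" .
    have "(\<Sum>i<D+1. card {y \<in> c i. adj v y}) = card (\<Union>i<D+1. {y \<in> c i. adj v y})"
      using fin by (subst card_UN_disjoint) (auto simp: c_def)
    also have "\<dots> \<le> card {u \<in> V. adj v u}"
      using fin by (intro card_mono) (auto simp: c_def)
    also have "\<dots> \<le> D" using deg[OF v] .
    finally have "4 * (\<Sum>i<D+1. card {y \<in> c i. adj v y}) \<le> 4 * D" by (rule mult_le_mono2)
    then have "(\<Sum>i<D+1. k i v) \<le> 2 * (D + 2) + 2 * (D + 1) + 4 * D"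
      by (rule order_trans[OF sum add_left_mono])
    also have "\<dots> = 8 * D + 6" by simp
    finally show "(\<Sum>i<D+1. k i v) \<le> 8 * D + 6" .
  qed
qed

section \<open>Forests and sparse graphs\<close>

text \<open>A forest, described by a building order in which every new vertex has at most one
  earlier neighbour; the interval representation is constructed along this order.\<close>

inductive one_degenerate :: "('a \<Rightarrow> 'a \<Rightarrow> bool) \<Rightarrow> 'a set \<Rightarrow> bool" for adj where
  empty: "one_degenerate adj {}"
| insert: "one_degenerate adj F \<Longrightarrow> v \<notin> F \<Longrightarrow>
    (\<And>x y. x \<in> F \<Longrightarrow> y \<in> F \<Longrightarrow> adj v x \<Longrightarrow> adj v y \<Longrightarrow> x = y) \<Longrightarrow> one_degenerate adj (insert v F)"

lemma one_degenerate_finite: "one_degenerate adj F \<Longrightarrow> finite F"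
  by (induction rule: one_degenerate.induct) auto

text \<open>\<open>h\<close> is the depth in a rooted forest, and in the construction below
  intervals meet only along ancestor lines. The clause on right ends is the induction invariant: an
  interval containing the right end of the interval of \<open>w\<close> belongs to \<open>w\<close>
  or to a shallower vertex.\<close>

definition forest_rep ::
    "('a \<Rightarrow> 'a \<Rightarrow> bool) \<Rightarrow> 'a set \<Rightarrow> ('a \<Rightarrow> real) \<Rightarrow> ('a \<Rightarrow> real) \<Rightarrow> ('a \<Rightarrow> nat) \<Rightarrow> bool" where
  "forest_rep adj F l r h \<longleftrightarrow> (\<forall>v\<in>F. l v < r v) \<and>
    (\<forall>u\<in>F. \<forall>v\<in>F. u \<noteq> v \<longrightarrow> l u \<le> r v \<longrightarrow> l v \<le> r u \<longrightarrow>
        (h u < h v \<and> r v < r u) \<or> (h v < h u \<and> r u < r v)) \<and>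
    (\<forall>u\<in>F. \<forall>v\<in>F. adj u v \<longleftrightarrow> l u \<le> r v \<and> l v \<le> r u \<and> (h u = Suc (h v) \<or> h v = Suc (h u)))"

text \<open>
  A new leaf \<open>v\<close> at \<open>w\<close> is put so close to the right end of the interval of \<open>w\<close> that it only meets \<open>w\<close> and the
  ancestors of \<open>w\<close>.
\<close>

lemma ex_forest_rep:
  assumes "one_degenerate adj F"
    and sym: "\<And>u v. adj u v \<Longrightarrow> adj v u" and irr: "\<And>v. \<not> adj v v"
  shows "\<exists>l r h. forest_rep adj F l r h"
  using assms(1)
proof (induction rule: one_degenerate.induct)
  case empty
  then show ?case by (simp add: forest_rep_def)
next
  case (insert F v)
  obtain l r h where rep: "forest_rep adj F l r h"
    using insert.IH by blast
  then have lr: "\<And>u. u \<in> F \<Longrightarrow> l u < r u"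
    and nest: "\<And>u w. u \<in> F \<Longrightarrow> w \<in> F \<Longrightarrow> u \<noteq> w \<Longrightarrow> l u \<le> r w \<Longrightarrow> l w \<le> r u \<Longrightarrow>
        (h u < h w \<and> r w < r u) \<or> (h w < h u \<and> r u < r w)"
    and adj: "\<And>u w. u \<in> F \<Longrightarrow> w \<in> F \<Longrightarrow>
       adj u w \<longleftrightarrow> l u \<le> r w \<and> l w \<le> r u \<and> (h u = Suc (h w) \<or> h w = Suc (h u))"
    by (simp_all add: forest_rep_def)
  have finF: "finite F" using insert.hyps(1) by (rule one_degenerate_finite)
  have "\<exists>lv rv hv. lv < rv \<and>
     (\<forall>u\<in>F. l u \<le> rv \<longrightarrow> lv \<le> r u \<longrightarrow> h u < hv \<and> rv < r u) \<and>
     (\<forall>u\<in>F. adj v u \<longleftrightarrow> l u \<le> rv \<and> lv \<le> r u \<and> hv = Suc (h u))"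
  proof (cases "\<exists>w\<in>F. adj v w")
    case False
    define m where "m = Max (insert 0 (r ` F)) + 1"
    have "r u < m" if "u \<in> F" for u
    proof -
      have "r u \<le> Max (insert 0 (r ` F))" using finF that by (intro Max_ge) auto
      then show ?thesis by (simp add: m_def)
    qed
    then have "\<not> m \<le> r u" if "u \<in> F" for u using that by fastforce
    then show ?thesis using False by (intro exI[of _ m] exI[of _ "m + 1"]) auto
  next
    case True
    then obtain w where w: "w \<in> F" "adj v w" by blast
    have only: "adj v u \<longleftrightarrow> u = w" if "u \<in> F" for u
      using insert.hyps(3) w that by blast
    \<comment> \<open>\<open>t\<close> is the last endpoint before \<open>r w\<close>, so the gap
      between them contains no endpoint, and an interval that meets the gap covers it and reaches
      \<open>r w\<close>.\<close>
    define P where "P = {x \<in> l ` F \<union> r ` F. x < r w}"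
    define t where "t = Max P"
    have finP: "finite P" using finF by (simp add: P_def)
    have "l w \<in> P" using w lr by (simp add: P_def)
    then have "t \<in> P" unfolding t_def using finP by (intro Max_in) auto
    then have t: "t < r w" by (simp add: P_def)
    have le_t: "x \<le> t" if "x \<in> l ` F \<union> r ` F" "x < r w" for x
      unfolding t_def using that finP by (intro Max_ge) (auto simp: P_def)
    obtain lv where lv: "t < lv" "lv < r w" using dense[OF t] by blast
    obtain rv where rv: "lv < rv" "rv < r w" using dense[OF lv(2)] by blast
    have inter: "l u \<le> t \<and> r w \<le> r u \<and> (u = w \<or> h u < h w)"
      if "u \<in> F" "l u \<le> rv" "lv \<le> r u" for u
    proof -
      have 1: "l u \<le> t" using that rv by (intro le_t) auto
      have 2: "r w \<le> r u"
        using le_t[of "r u"] that lv by (meson UnI2 imageI linorder_not_le order_trans)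
      have "u = w \<or> h u < h w"
      proof (cases "u = w")
        case False
        have "l w \<le> t" using lr[OF w(1)] w by (intro le_t) auto
        then have "l u \<le> r w" "l w \<le> r u" using 1 2 t by auto
        then show ?thesis using nest[OF that(1) w(1) False] 2 by auto
      qed simp
      then show ?thesis using 1 2 by simp
    qed
    have w_inter: "l w \<le> rv" "lv \<le> r w"
      using le_t[of "l w"] lr[OF w(1)] w rv lv by auto
    show ?thesis
    proof (rule exI[of _ lv], rule exI[of _ rv], rule exI[of _ "Suc (h w)"], intro conjI ballI impI)
      show "lv < rv" by (rule rv(1))
    next
      fix u assume "u \<in> F" "l u \<le> rv" "lv \<le> r u"
      then show "h u < Suc (h w)" "rv < r u" using inter[of u] rv by auto
    next
      fix u assume u: "u \<in> F"
      show "adj v u \<longleftrightarrow> l u \<le> rv \<and> lv \<le> r u \<and> Suc (h w) = Suc (h u)"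
        using only[OF u] inter[OF u] w_inter by auto
    qed
  qed
  then obtain lv rv :: real and hv :: nat where new: "lv < rv"
     "\<And>u. u \<in> F \<Longrightarrow> l u \<le> rv \<Longrightarrow> lv \<le> r u \<Longrightarrow> h u < hv \<and> rv < r u"
     "\<And>u. u \<in> F \<Longrightarrow> adj v u \<longleftrightarrow> l u \<le> rv \<and> lv \<le> r u \<and> hv = Suc (h u)" by blast
  define l' r' h' where "l' = l(v := lv)" and "r' = r(v := rv)" and "h' = h(v := hv)"
  have old: "l' u = l u" "r' u = r u" "h' u = h u" if "u \<in> F" for u
    using that insert.hyps(2) by (auto simp: l'_def r'_def h'_def)
  have v: "l' v = lv" "r' v = rv" "h' v = hv" by (simp_all add: l'_def r'_def h'_def)
  have "l' u < r' u" if "u \<in> insert v F" for u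
    using that old v new(1) lr by auto
  moreover have "(h' u < h' w \<and> r' w < r' u) \<or> (h' w < h' u \<and> r' u < r' w)"
    if "u \<in> insert v F" "w \<in> insert v F" "u \<noteq> w" "l' u \<le> r' w" "l' w \<le> r' u" for u w
    using that nest[of u w] new(2)[of u] new(2)[of w] by (auto simp: old v)
  moreover have "adj u w \<longleftrightarrow> l' u \<le> r' w \<and> l' w \<le> r' u \<and> (h' u = Suc (h' w) \<or> h' w = Suc (h' u))"
    if "u \<in> insert v F" "w \<in> insert v F" for u w
  proof -
    have vF: "adj v x \<longleftrightarrow> l x \<le> rv \<and> lv \<le> r x \<and> (hv = Suc (h x) \<or> h x = Suc hv)" if "x \<in> F" for x
      using new(2)[of x] new(3)[of x] that by auto
    have symx: "adj x v \<longleftrightarrow> adj v x" for x using sym by blast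
    consider "u = v" "w = v" | "u = v" "w \<in> F" | "u \<in> F" "w = v" | "u \<in> F" "w \<in> F"
      using \<open>u \<in> insert v F\<close> \<open>w \<in> insert v F\<close> by blast
    then show ?thesis
    proof cases
      case 1
      then show ?thesis using irr by simp
    next
      case 2
      then show ?thesis using vF[of w] by (auto simp: old v)
    next
      case 3
      then show ?thesis using vF[of u] symx[of u] by (auto simp: old v)
    next
      case 4
      then show ?thesis using adj by (simp add: old)
    qed
  qed
  ultimately have "forest_rep adj (insert v F) l' r' h'"
    unfolding forest_rep_def by simp
  then show ?case by blast
qed

text \<open>Two dimensions suffice: the intervals of the representation, and unit intervals starting
  at the depth, which are disjoint once depths differ by at least 2. Meeting intervals of distinct
  vertices never have equal depth, so a pair left unseparated has depths differing by exactly one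
  and is adjacent.\<close>

lemma separable_forest:
  assumes "one_degenerate adj F"
    and sym: "\<And>u v. adj u v \<Longrightarrow> adj v u" and irr: "\<And>v. \<not> adj v v"
  shows "separable F adj (\<lambda>u v. u \<noteq> v \<and> \<not> adj u v) (\<lambda>_. 2)"
proof -
  obtain l r h where rep: "forest_rep adj F l r h"
    using ex_forest_rep[OF assms] by blast
  then have lr: "\<And>u. u \<in> F \<Longrightarrow> l u < r u"
    and nest: "\<And>u w. u \<in> F \<Longrightarrow> w \<in> F \<Longrightarrow> u \<noteq> w \<Longrightarrow> l u \<le> r w \<Longrightarrow> l w \<le> r u \<Longrightarrow>
        (h u < h w \<and> r w < r u) \<or> (h w < h u \<and> r u < r w)"
    and adj: "\<And>u w. u \<in> F \<Longrightarrow> w \<in> F \<Longrightarrow>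
       adj u w \<longleftrightarrow> l u \<le> r w \<and> l w \<le> r u \<and> (h u = Suc (h w) \<or> h w = Suc (h u))"
    by (simp_all add: forest_rep_def)
  define I where "I = (\<lambda>(b::bool) v. if b then {l v..r v} else {real (h v)..real (h v) + 1})"
  show ?thesis
  proof (rule separable_family[of UNIV _ _ I])
    fix b
    show "valid_dim F adj (I b)"
      using lr adj by (auto simp: valid_dim_def I_def less_imp_le real_interval_Icc Int_atLeastAtMost)
  next
    fix u v assume uv: "u \<in> F" "v \<in> F" "u \<noteq> v \<and> \<not> adj u v"
    have "\<not> (l u \<le> r v \<and> l v \<le> r u) \<or> Suc (h u) < h v \<or> Suc (h v) < h u"
      using adj[of u v] nest[of u v] uv by linarith
    then have "I True u \<inter> I True v = {} \<or> I False u \<inter> I False v = {}"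
      by (auto simp: I_def Int_atLeastAtMost)
    then show "\<exists>b\<in>UNIV. I b u \<inter> I b v = {}" by blast
  next
    fix v
    show "card {b \<in> UNIV. bounded (I b v)} \<le> 2"
      using card_mono[of "UNIV::bool set" "{b \<in> UNIV. bounded (I b v)}"] by simp
  qed simp
qed

section \<open>Splitting a sparse graph into a forest and an independent set\<close>

lemma one_degenerate_insert:
  assumes "one_degenerate adj F" "{x \<in> F. adj v x} \<subseteq> {w}"
  shows "one_degenerate adj (insert v F)"
proof (cases "v \<in> F")
  case False
  with assms show ?thesis by (intro one_degenerate.insert) blast+
qed (use assms in \<open>simp add: insert_absorb\<close>)

text \<open>\<open>I\<close> will serve as a single colour class: since a vertex of \<open>F\<close>
  has at most one neighbour in \<open>I\<close>, a constant \<open>\<phi>\<close> is already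
  injective on neighbourhoods.\<close>

definition split_forest :: "('a \<Rightarrow> 'a \<Rightarrow> bool) \<Rightarrow> 'a set \<Rightarrow> 'a set \<Rightarrow> 'a set \<Rightarrow> bool" where
  "split_forest adj W I F \<longleftrightarrow> W = I \<union> F \<and> I \<inter> F = {} \<and> (\<forall>x\<in>I. \<forall>y\<in>I. \<not> adj x y) \<and>
     (\<forall>u\<in>F. \<forall>x\<in>I. \<forall>y\<in>I. adj u x \<longrightarrow> adj u y \<longrightarrow> x = y) \<and> one_degenerate adj F"

lemma split_forestD:
  assumes "split_forest adj W I F"
  shows "W = I \<union> F" "I \<inter> F = {}" "one_degenerate adj F"
    "\<And>x y. x \<in> I \<Longrightarrow> y \<in> I \<Longrightarrow> \<not> adj x y"
    "\<And>u x y. u \<in> F \<Longrightarrow> x \<in> I \<Longrightarrow> y \<in> I \<Longrightarrow> adj u x \<Longrightarrow> adj u y \<Longrightarrow> x = y"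
  using assms by (auto simp: split_forest_def)

lemma split_forest_leaf:
  assumes "split_forest adj W I F" "v \<notin> W" "{x \<in> W. adj v x} \<subseteq> {w}"
  shows "split_forest adj (insert v W) I (insert v F)"
proof -
  have "one_degenerate adj (insert v F)"
    by (rule one_degenerate_insert[of _ _ _ w]) (use assms in \<open>auto simp: split_forest_def\<close>)
  moreover have "x = y" if "u \<in> insert v F" "x \<in> I" "y \<in> I" "adj u x" "adj u y" for u x y
  proof (cases "u = v")
    case True
    have "x \<in> W" "y \<in> W" using that split_forestD(1)[OF assms(1)] by auto
    then have "x \<in> {w}" "y \<in> {w}" using assms(3) that True by auto
    then show ?thesis by simp
  next
    case False
    then show ?thesis using split_forestD(5)[OF assms(1), of u x y] that by simp
  qed
  moreover have "insert v W = I \<union> insert v F" "I \<inter> insert v F = {}"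
    using split_forestD(1,2)[OF assms(1)] assms(2) by auto
  ultimately show ?thesis
    using split_forestD(4)[OF assms(1)] unfolding split_forest_def by simp
qed

text \<open>Here \<open>w\<close> and \<open>w'\<close> are the remaining neighbours of the ends of
  the path \<open>a\<close>, \<open>b\<close>, \<open>c\<close>. If one of them lies in
  \<open>I\<close>, the whole path can join the forest, attached to \<open>F\<close> at most at its
  other end. Otherwise \<open>b\<close> goes to \<open>I\<close>, while \<open>a\<close> and
  \<open>c\<close> join the forest with at most one earlier neighbour each and see only
  \<open>b\<close> in the new \<open>I\<close>. A triangle, with \<open>w = c\<close> and
  \<open>w' = a\<close>, falls under the last case.\<close>

lemma split_forest_path:
  assumes sp: "split_forest adj W I F"
    and abc: "a \<notin> W" "b \<notin> W" "c \<notin> W" "a \<noteq> b" "b \<noteq> c" "a \<noteq> c"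
    and sym: "\<And>u v. adj u v \<Longrightarrow> adj v u" and irr: "\<And>v. \<not> adj v v"
    and na: "{x \<in> W \<union> {a, b, c}. adj a x} \<subseteq> {b, w}"
    and nb: "{x \<in> W \<union> {a, b, c}. adj b x} \<subseteq> {a, c}"
    and nc: "{x \<in> W \<union> {a, b, c}. adj c x} \<subseteq> {b, w'}"
  shows "\<exists>I F. split_forest adj (W \<union> {a, b, c}) I F"
proof -
  note W = split_forestD(1,2)[OF sp] and deg = split_forestD(3)[OF sp]
    and indep = split_forestD(4)[OF sp] and uniq = split_forestD(5)[OF sp]
  have fold_all: "split_forest adj (W \<union> {a, b, c}) I (insert a (insert b (insert c F)))"
    if "one_degenerate adj (insert a (insert b (insert c F)))"
    unfolding split_forest_def
  proof (intro conjI ballI impI)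
    fix u x y assume uxy: "u \<in> insert a (insert b (insert c F))" "x \<in> I" "y \<in> I" "adj u x" "adj u y"
    have xy: "x \<in> W" "y \<in> W" using uxy W by auto
    consider "u = a" | "u = b" | "u = c" | "u \<in> F" using uxy(1) by blast
    then show "x = y"
    proof cases
      case 1
      then have "x \<in> {b, w}" "y \<in> {b, w}" using na xy uxy by auto
      then show ?thesis using xy abc by auto
    next
      case 2
      then have "x \<in> {a, c}" using nb xy uxy by auto
      then show ?thesis using xy abc by auto
    next
      case 3
      then have "x \<in> {b, w'}" "y \<in> {b, w'}" using nc xy uxy by auto
      then show ?thesis using xy abc by auto
    next
      case 4
      then show ?thesis using uniq uxy by simp
    qed
  qed (use W abc indep that in auto)
  consider "w \<in> I" | "w' \<in> I" | "w \<notin> I" "w' \<notin> I" by blast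
  then show ?thesis
  proof cases
    case 1
    have "one_degenerate adj (insert c F)"
      using deg by (rule one_degenerate_insert[of _ _ _ w']) (use nc W abc in auto)
    then have "one_degenerate adj (insert b (insert c F))"
      by (rule one_degenerate_insert[of _ _ _ c]) (use nb W abc in auto)
    then have "one_degenerate adj (insert a (insert b (insert c F)))"
      by (rule one_degenerate_insert[of _ _ _ b]) (use na W abc 1 irr in auto)
    then show ?thesis using fold_all by blast
  next
    case 2
    have "one_degenerate adj (insert a F)"
      using deg by (rule one_degenerate_insert[of _ _ _ w]) (use na W abc in auto)
    then have "one_degenerate adj (insert b (insert a F))"
      by (rule one_degenerate_insert[of _ _ _ a]) (use nb W abc in auto)
    then have "one_degenerate adj (insert c (insert b (insert a F)))"
      by (rule one_degenerate_insert[of _ _ _ b]) (use nc W abc 2 irr in auto)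
    then show ?thesis using fold_all by (auto simp: insert_commute)
  next
    case 3
    have "one_degenerate adj (insert a F)"
      using deg by (rule one_degenerate_insert[of _ _ _ w]) (use na W abc in auto)
    then have deg': "one_degenerate adj (insert c (insert a F))"
      by (rule one_degenerate_insert[of _ _ _ w']) (use nc W abc in auto)
    have "split_forest adj (W \<union> {a, b, c}) (insert b I) (insert c (insert a F))"
      unfolding split_forest_def
    proof (intro conjI ballI impI)
      fix x y assume xy: "x \<in> insert b I" "y \<in> insert b I"
      have "\<not> adj b z" "\<not> adj z b" if "z \<in> I" for z
        using that nb W abc sym by - (blast+)
      then show "\<not> adj x y" using xy indep irr by blast
    next
      fix u x y assume uxy: "u \<in> insert c (insert a F)" "x \<in> insert b I" "y \<in> insert b I" "adj u x" "adj u y"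
      have "\<not> adj a z" "\<not> adj c z" if "z \<in> I" for z
        using that 3 na nc W abc by - (blast+)
      moreover have "\<not> adj u b" if "u \<in> F" for u
        using that nb W abc sym by blast
      ultimately show "x = y" using uxy uniq[of u x y] by auto
    qed (use W abc deg' in auto)
    then show ?thesis by blast
  qed
qed

lemma card_2_mem: "card A = 2 \<Longrightarrow> b \<in> A \<Longrightarrow> \<exists>w. A = {b, w}"
  by (auto simp: card_2_iff)

lemma card_le_1_subset:
  assumes "finite A" "card A \<le> 1"
  shows "\<exists>w. A \<subseteq> {w}"
proof (cases "A = {}")
  case False
  then obtain w where "w \<in> A" by blast
  then show ?thesis using assms card_le_Suc0_iff_eq[of A] by auto
qed simp

text \<open>
  A minimal counterexample has minimum degree 2 and no vertex of degree 2 with both neighbours of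
  degree 2 (\<open>split_forest_path\<close>); so the number of vertices of degree 2 is at most the sum of the
  other degrees, which contradicts the sparsity.
\<close>

lemma ex_split_forest:
  assumes "finite W"
    and sym: "\<And>u v. adj u v \<Longrightarrow> adj v u" and irr: "\<And>v. \<not> adj v v"
    and sparse: "\<And>S. S \<subseteq> W \<Longrightarrow> S \<noteq> {} \<Longrightarrow> 4 * (\<Sum>v\<in>S. card {u \<in> S. adj v u}) < 9 * card S"
  shows "\<exists>I F. split_forest adj W I F"
  using assms(1,4)
proof (induction W rule: finite_psubset_induct)
  case (psubset W)
  define N where "N = (\<lambda>v. {u \<in> W. adj v u})"
  have finN: "finite (N v)" for v using psubset.hyps by (simp add: N_def)
  have IH: "\<exists>I F. split_forest adj S I F" if "S \<subset> W" for S
    using psubset.IH[OF that] psubset.prems that by (meson order_trans psubset_imp_subset)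
  consider "W = {}" | v where "v \<in> W" "card (N v) \<le> 1"
    | b where "b \<in> W" "card (N b) = 2" "\<forall>x\<in>N b. card (N x) = 2"
    | "W \<noteq> {}" "\<forall>v\<in>W. card (N v) \<ge> 2" "\<forall>b\<in>W. card (N b) = 2 \<longrightarrow> (\<exists>x\<in>N b. card (N x) \<noteq> 2)"
    by fastforce
  then show ?case
  proof cases
    case 1
    then show ?thesis by (auto simp: split_forest_def intro: one_degenerate.empty)
  next
    case (2 v)
    then obtain I F where sp: "split_forest adj (W - {v}) I F" using IH[of "W - {v}"] by blast
    have "\<exists>w. N v \<subseteq> {w}"
      using card_le_1_subset[OF finN 2(2)] .
    then obtain w where "N v \<subseteq> {w}" by blast
    then have "split_forest adj (insert v (W - {v})) I (insert v F)"
      by (intro split_forest_leaf[OF sp]) (auto simp: N_def)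
    then show ?thesis using 2(1) by (metis insert_Diff)
  next
    case (3 b)
    from 3(2) obtain a c where ac: "N b = {a, c}" "a \<noteq> c" by (meson card_2_iff)
    have W: "a \<in> W" "c \<in> W" "adj b a" "adj b c" using ac by (auto simp: N_def)
    have "b \<in> N a" "b \<in> N c" using W sym 3(1) by (auto simp: N_def)
    moreover have "card (N a) = 2" "card (N c) = 2" using 3(3) ac by auto
    ultimately obtain w w' where w: "N a = {b, w}" "N c = {b, w'}"
      using card_2_mem by metis
    obtain I F where sp: "split_forest adj (W - {a, b, c}) I F" using IH[of "W - {a, b, c}"] W by blast
    have eq: "(W - {a, b, c}) \<union> {a, b, c} = W" using W 3(1) by blast
    have ne: "a \<noteq> b" "b \<noteq> c" using W irr by auto
    have "\<exists>I F. split_forest adj ((W - {a, b, c}) \<union> {a, b, c}) I F"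
    proof (rule split_forest_path[OF sp _ _ _ _ _ _ sym irr])
      show "{x \<in> W - {a, b, c} \<union> {a, b, c}. adj a x} \<subseteq> {b, w}"
        unfolding eq using w(1) by (auto simp: N_def)
      show "{x \<in> W - {a, b, c} \<union> {a, b, c}. adj b x} \<subseteq> {a, c}"
        unfolding eq using ac(1) by (auto simp: N_def)
      show "{x \<in> W - {a, b, c} \<union> {a, b, c}. adj c x} \<subseteq> {b, w'}"
        unfolding eq using w(2) by (auto simp: N_def)
    qed (use ne ac in auto)
    then show ?thesis unfolding eq .
  next
    case 4
    define T B where "T = {v \<in> W. card (N v) = 2}" and "B = {v \<in> W. card (N v) \<ge> 3}"
    have TB: "W = T \<union> B" "T \<inter> B = {}" "finite T" "finite B"
      using 4(2) psubset.hyps by (auto simp: T_def B_def)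
    define d where "d = (\<Sum>v\<in>B. card (N v))"
    have "T \<subseteq> (\<Union>x\<in>B. N x)"
    proof
      fix v assume v: "v \<in> T"
      then obtain x where x: "x \<in> N v" "card (N x) \<noteq> 2" using 4(3) by (auto simp: T_def)
      then have "x \<in> B" using 4(2) by (force simp: B_def N_def)
      moreover have "v \<in> N x" using x v sym by (auto simp: N_def T_def)
      ultimately show "v \<in> (\<Union>x\<in>B. N x)" by blast
    qed
    then have "card T \<le> card (\<Union>x\<in>B. N x)" using TB finN by (intro card_mono) auto
    also have "\<dots> \<le> d" unfolding d_def using TB by (intro card_UN_le) auto
    finally have T: "card T \<le> d" .
    have "of_nat (card B) * 3 \<le> d"
      unfolding d_def by (rule sum_bounded_below) (simp add: B_def)
    then have B: "3 * card B \<le> d" by simp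
    have "(\<Sum>v\<in>W. card (N v)) = (\<Sum>v\<in>T. card (N v)) + d"
      unfolding d_def using TB by (subst TB(1), subst sum.union_disjoint) auto
    also have "(\<Sum>v\<in>T. card (N v)) = 2 * card T" by (simp add: T_def)
    \<comment> \<open>From \<open>card T \<le> d\<close> and \<open>3 * card B \<le> d\<close>
      follows \<open>8 * card T + 4 * d \<ge> 9 * card T + 9 * card B\<close>; this computation is
      the origin of the ratio 9/8 of edges to vertices.\<close>
    finally have "4 * (\<Sum>v\<in>W. card (N v)) \<ge> 9 * card W"
      using T B TB by (simp add: card_Un_disjoint)
    then show ?thesis using psubset.prems[of W] 4(1) by (simp add: N_def)
  qed
qed

text \<open>The forest costs 2. The class \<open>I\<close> needs only the one-node tree
  \<open>L = 0\<close>: 2 for its members and \<open>2 + 4 * 1\<close> for a vertex of the forest,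
  which sees at most one of them. A forest vertex thus pays 2 + 6 = 8.\<close>

lemma separable_sparse:
  assumes fin: "finite W"
    and sym: "\<And>u v. adj u v \<Longrightarrow> adj v u" and irr: "\<And>v. \<not> adj v v"
    and "\<And>S. S \<subseteq> W \<Longrightarrow> S \<noteq> {} \<Longrightarrow> 4 * (\<Sum>v\<in>S. card {u \<in> S. adj v u}) < 9 * card S"
  shows "separable W adj (\<lambda>u v. u \<noteq> v \<and> \<not> adj u v) (\<lambda>_. 8)"
proof -
  obtain I F where sp: "split_forest adj W I F" using ex_split_forest[OF assms] by blast
  note W = split_forestD(1,2)[OF sp] and deg = split_forestD(3)[OF sp]
    and indep = split_forestD(4)[OF sp] and uniq = split_forestD(5)[OF sp]
  have 1: "separable W adj (\<lambda>u v. u \<in> F \<and> v \<in> F \<and> u \<noteq> v \<and> \<not> adj u v) (\<lambda>v. if v \<in> F then 2 else 0)"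
    using W by (intro separable_extend separable_forest[OF deg sym irr]) auto
  have 2: "separable W adj (\<lambda>u v. v \<in> I \<and> u \<noteq> v \<and> \<not> adj u v)
      (\<lambda>v. if v \<in> I then 2 * (0 + 1) else 2 + 4 * card {y \<in> I. adj v y})"
  proof (rule separable_class[where \<phi> = "\<lambda>_. 0", OF fin _ sym indep])
    fix u assume "u \<in> W - I"
    then show "inj_on (\<lambda>_. 0::nat) {y \<in> I. adj u y}"
      using uniq[of u] W by (auto intro!: inj_onI)
  qed (use W in auto)
  have card1: "card {y \<in> I. adj v y} \<le> 1" if "v \<in> F" for v
    using uniq[OF that] fin W by (subst card_le_Suc0_iff_eq[unfolded One_nat_def[symmetric]]) auto
  show ?thesis
  proof (rule separable_mono[OF separable_disj[OF 1 2]])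
    fix v assume "v \<in> W"
    then show "(if v \<in> F then 2 else 0) + (if v \<in> I then 2 * (0 + 1) else 2 + 4 * card {y \<in> I. adj v y}) \<le> 8"
      using card1[of v] W by auto
  qed (use W sym in blast)
qed

text \<open>With \<open>W\<close> the closed neighbourhood of \<open>X\<close>, a pair lies inside
  \<open>W\<close>, or avoids \<open>X\<close>, or joins \<open>X\<close> to the complement of
  \<open>W\<close>. These cost 8, \<open>8 * D + 6\<close> and 1: for the last, \<open>f\<close>
  puts \<open>X\<close> at 0, the complement of \<open>W\<close> at 1 and leaves the rest of
  \<open>W\<close> unbounded, which respects all edges since none runs from \<open>X\<close> to the
  complement of \<open>W\<close>.\<close>

lemma separable_high_degree:
  assumes fin: "finite V" and "X \<subseteq> V"
    and sym: "\<And>u v. adj u v \<Longrightarrow> adj v u" and irr: "\<And>v. \<not> adj v v"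
    and deg: "\<And>v. v \<in> V - X \<Longrightarrow> card {u \<in> V. adj v u} \<le> D"
    and sparse: "\<And>S. S \<subseteq> X \<union> {u \<in> V. \<exists>x\<in>X. adj x u} \<Longrightarrow> S \<noteq> {} \<Longrightarrow>
        4 * (\<Sum>v\<in>S. card {u \<in> S. adj v u}) < 9 * card S"
  shows "separable V adj (\<lambda>u v. u \<noteq> v \<and> \<not> adj u v) (\<lambda>_. 8 * D + 15)"
proof -
  define W where "W = X \<union> {u \<in> V. \<exists>x\<in>X. adj x u}"
  have WV: "W \<subseteq> V" using assms(2) by (auto simp: W_def)
  have finW: "finite W" using WV fin finite_subset by blast
  define f where "f = (\<lambda>v. if v \<in> X then {0::real..0} else if v \<in> W then UNIV else {1..1})"
  have 1: "separable V adj (\<lambda>u v. u \<in> W \<and> v \<in> W \<and> u \<noteq> v \<and> \<not> adj u v) (\<lambda>v. if v \<in> W then 8 else 0)"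
    using WV by (intro separable_extend separable_sparse[OF finW sym irr sparse]) (auto simp: W_def)
  have "separable (V - X) adj (\<lambda>u v. u \<noteq> v \<and> \<not> adj u v) (\<lambda>_. 8 * D + 6)"
  proof (rule separable_max_degree[OF _ sym irr])
    fix v assume v: "v \<in> V - X"
    have "card {u \<in> V - X. adj v u} \<le> card {u \<in> V. adj v u}"
      using fin by (intro card_mono) auto
    then show "card {u \<in> V - X. adj v u} \<le> D" using deg[OF v] by linarith
  qed (use fin in auto)
  then have 2: "separable V adj (\<lambda>u v. u \<in> V - X \<and> v \<in> V - X \<and> u \<noteq> v \<and> \<not> adj u v)
      (\<lambda>v. if v \<in> V - X then 8 * D + 6 else 0)"
    by (rule separable_extend) auto
  have 3: "separable V adj (\<lambda>u v. u \<in> X \<and> v \<notin> W) (\<lambda>_. 1)"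
  proof (rule separable_family[of "{()}" _ _ "\<lambda>_. f"])
    show "valid_dim V adj f"
      using sym real_interval_Icc[of 0 0] real_interval_Icc[of 1 1]
      by (auto simp: valid_dim_def f_def W_def real_interval_UNIV)
  next
    fix u v assume "u \<in> V" "v \<in> V" "u \<in> X \<and> v \<notin> W"
    then show "\<exists>i\<in>{()}. f u \<inter> f v = {}" by (auto simp: f_def W_def)
  next
    fix v
    show "card {i \<in> {()}. bounded (f v)} \<le> 1"
      using card_mono[of "{()}" "{i \<in> {()}. bounded (f v)}"] by auto
  qed auto
  show ?thesis
  proof (rule separable_mono[OF separable_disj[OF separable_disj[OF 1 2] 3]])
    fix u v assume "u \<in> V" "v \<in> V" "u \<noteq> v \<and> \<not> adj u v"
    moreover have "X \<subseteq> W" by (auto simp: W_def)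
    ultimately show "((u \<in> W \<and> v \<in> W \<and> u \<noteq> v \<and> \<not> adj u v \<or>
        u \<in> V - X \<and> v \<in> V - X \<and> u \<noteq> v \<and> \<not> adj u v) \<or> u \<in> X \<and> v \<notin> W) \<or>
       (v \<in> W \<and> u \<in> W \<and> v \<noteq> u \<and> \<not> adj v u \<or>
        v \<in> V - X \<and> u \<in> V - X \<and> v \<noteq> u \<and> \<not> adj v u) \<or> v \<in> X \<and> u \<notin> W"
      using sym by blast
  qed auto
qed

section \<open>Counting graphs of small local boxicity\<close>

text \<open>
  The sets of predecessors form a chain, so that they can be replaced by their cardinalities.
\<close>

lemma interval_order_code:
  fixes R :: "nat \<Rightarrow> nat \<Rightarrow> bool"
  assumes lt: "\<And>u v. R u v \<Longrightarrow> u < n"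
    and io: "\<And>u v u' v'. R u v \<Longrightarrow> R u' v' \<Longrightarrow> R u v' \<or> R u' v"
  shows "\<exists>a b. (\<forall>v. a v \<le> n) \<and> (\<forall>u. 0 < b u \<and> b u \<le> n + 1) \<and> (\<forall>u v. R u v \<longleftrightarrow> b u \<le> (a v :: nat))"
proof -
  define a where "a = (\<lambda>v. card {w. R w v})"
  \<comment> \<open>The default \<open>n + 1\<close> exceeds every value of \<open>a\<close>, so
    that a vertex preceding nothing stays so in the code.\<close>
  define b where "b = (\<lambda>u. if \<exists>v. R u v then LEAST m. \<exists>v. R u v \<and> m = a v else n + 1)"
  have sub: "{w. R w v} \<subseteq> {..<n}" for v using lt by auto
  have fin: "finite {w. R w v}" for v using sub finite_subset by blast
  have a_le: "a v \<le> n" for v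
    using card_mono[OF _ sub[of v]] by (simp add: a_def)
  have b_ex: "\<exists>v. R u v \<and> b u = a v" if "R u v" for u v
  proof -
    have "\<exists>v'. R u v' \<and> (LEAST m. \<exists>v. R u v \<and> m = a v) = a v'"
      using LeastI[of "\<lambda>m. \<exists>v. R u v \<and> m = a v" "a v"] that by blast
    then show ?thesis using that by (auto simp: b_def)
  qed
  have b_le: "b u \<le> a v" if "R u v" for u v
    using Least_le[of "\<lambda>m. \<exists>v. R u v \<and> m = a v" "a v"] that by (auto simp: b_def)
  have a_pos: "0 < a v" if "R u v" for u v
    using that fin[of v] by (auto simp: a_def card_gt_0_iff)
  have b_bounds: "0 < b u \<and> b u \<le> n + 1" for u
  proof (cases "\<exists>v. R u v")
    case True
    then obtain v where v: "R u v" by blast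
    obtain v' where v': "R u v'" "b u = a v'" using b_ex[OF v] by blast
    show ?thesis using v' a_pos[OF v'(1)] a_le[of v'] by simp
  next
    case False
    then have "b u = n + 1" unfolding b_def by (rule if_not_P)
    then show ?thesis by simp
  qed
  have "R u v" if "b u \<le> a v" for u v
  proof -
    have "\<exists>v. R u v"
    proof (rule ccontr)
      assume "\<nexists>v. R u v"
      then have "b u = n + 1" by (auto simp: b_def)
      then show False using that a_le[of v] by simp
    qed
    then obtain v' where v': "R u v'" "b u = a v'" using b_ex by blast
    show "R u v"
    proof (rule ccontr)
      assume neg: "\<not> R u v"
      have "{w. R w v} \<subseteq> {w. R w v'}" using io[OF v'(1)] neg by blast
      moreover have "u \<in> {w. R w v'} - {w. R w v}" using neg v' by simp
      ultimately have "a v < a v'"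
        unfolding a_def using fin by (intro psubset_card_mono) auto
      then show False using that v' by simp
    qed
  qed
  then have "\<forall>u v. R u v \<longleftrightarrow> b u \<le> a v" using b_le by blast
  then show ?thesis using a_le b_bounds by (intro exI[of _ a] exI[of _ b]) simp
qed

text \<open>A code gives each vertex \<open>d\<close> slots, one for each dimension in which it is
  bounded, holding a name of the dimension and the numbers \<open>a\<close> and \<open>b\<close> of
  \<open>interval_order_code\<close>; \<open>b u \<le> a v\<close> in a common dimension says that
  \<open>u\<close> lies entirely to the left of \<open>v\<close>.\<close>

definition before_code :: "nat \<Rightarrow> (nat \<times> nat \<Rightarrow> nat \<times> nat \<times> nat) \<Rightarrow> nat \<Rightarrow> nat \<Rightarrow> bool" where
  "before_code d c u v \<longleftrightarrow>
     (\<exists>s<d. \<exists>t<d. fst (c (u, s)) = fst (c (v, t)) \<and> snd (snd (c (u, s))) \<le> fst (snd (c (v, t))))"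

definition decode :: "nat \<Rightarrow> nat \<Rightarrow> (nat \<times> nat \<Rightarrow> nat \<times> nat \<times> nat) \<Rightarrow> nat set set" where
  "decode n d c = {e \<in> all_edges {..<n}. \<forall>u v. e = {u, v} \<longrightarrow> \<not> before_code d c u v}"

text \<open>Only dimensions in which some vertex is bounded matter, at most \<open>n * d\<close> in
  all, so this many names suffice whatever the ambient dimension was.\<close>

definition codes :: "nat \<Rightarrow> nat \<Rightarrow> (nat \<times> nat \<Rightarrow> nat \<times> nat \<times> nat) set" where
  "codes n d = {..<n} \<times> {..<d} \<rightarrow>\<^sub>E {..<n * d} \<times> {..<n + 2} \<times> {..<n + 2}"

lemma finite_codes: "finite (codes n d)"
  by (simp add: codes_def finite_PiE)

lemma card_codes: "card (codes n d) = (n * d * (n + 2) ^ 2) ^ (n * d)"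
  by (simp add: codes_def card_PiE card_cartesian_product power2_eq_square)

text \<open>Two boxes are disjoint iff in some dimension both intervals are bounded and one lies
  entirely before the other, since a nonempty interval always meets the whole line. The precedence
  relations \<open>R i\<close> are interval orders, so a code determines the whole intersection
  pattern.\<close>

lemma ex_code:
  assumes E: "E \<subseteq> all_edges {..<n}" and rep: "has_local_box_rep {..<n} E k" and k: "k \<le> d"
  shows "\<exists>c\<in>codes n d. decode n d c = E"
proof -
  obtain d' B where B: "\<forall>v\<in>{..<n}. local_box k d' (B v)"
    and E_iff: "\<And>u v. u < n \<Longrightarrow> v < n \<Longrightarrow> u \<noteq> v \<Longrightarrow> {u, v} \<in> E \<longleftrightarrow> B u \<inter> B v \<noteq> {}"
    using rep unfolding has_local_box_rep_def by auto
  have "\<forall>v\<in>{..<n}. \<exists>I. (\<forall>i<d'. real_interval (I i)) \<and> B v = (\<Pi>\<^sub>E i\<in>{..<d'}. I i) \<and>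
          card {i. i < d' \<and> bounded (I i)} \<le> k"
    using B unfolding local_box_def .
  then obtain I where I: "\<forall>v\<in>{..<n}. (\<forall>i<d'. real_interval (I v i)) \<and> B v = (\<Pi>\<^sub>E i\<in>{..<d'}. I v i) \<and>
          card {i. i < d' \<and> bounded (I v i)} \<le> k"
    using bchoice by metis
  define bd where "bd = (\<lambda>v. {i. i < d' \<and> bounded (I v i)})"
  have fin_bd: "finite (bd v)" for v by (simp add: bd_def)
  have card_bd: "card (bd v) \<le> d" if "v < n" for v
    using I that order_trans[OF _ k, of "card (bd v)"] by (simp add: bd_def)
  have disjoint_iff: "{u, v} \<in> E \<longleftrightarrow> (\<forall>i<d'. I u i \<inter> I v i \<noteq> {})" if "u < n" "v < n" "u \<noteq> v" for u v
  proof -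
    have "B u = (\<Pi>\<^sub>E i\<in>{..<d'}. I u i)" "B v = (\<Pi>\<^sub>E i\<in>{..<d'}. I v i)" using I that by auto
    then have "B u \<inter> B v \<noteq> {} \<longleftrightarrow> (\<forall>i<d'. I u i \<inter> I v i \<noteq> {})"
      by (auto simp: PiE_Int PiE_eq_empty_iff)
    then show ?thesis using E_iff[OF that] by simp
  qed
  define R where "R = (\<lambda>i u v. u < n \<and> v < n \<and> i \<in> bd u \<and> i \<in> bd v \<and> (\<forall>x\<in>I u i. \<forall>y\<in>I v i. x < y))"
  have ri: "real_interval (I v i)" if "v < n" "i < d'" for v i
    using I that by simp
  have ne: "I v i \<noteq> {}" if "v < n" "i < d'" for v i
    using ri[OF that] by (auto simp: real_interval_def)
  \<comment> \<open>If both failed, there would be points with \<open>y' \<le> x\<close> and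
    \<open>y \<le> x'\<close>; together with \<open>x < y\<close> and \<open>x' < y'\<close> this is
    a cycle.\<close>
  have "R i u v' \<or> R i u' v" if "R i u v" "R i u' v'" for i u v u' v'
  proof (rule ccontr)
    assume neg: "\<not> (R i u v' \<or> R i u' v)"
    have mem: "u < n" "v < n" "u' < n" "v' < n" "i \<in> bd u" "i \<in> bd v" "i \<in> bd u'" "i \<in> bd v'"
      using that by (simp_all add: R_def)
    have "\<exists>x\<in>I u i. \<exists>y\<in>I v' i. \<not> x < y" "\<exists>x\<in>I u' i. \<exists>y\<in>I v i. \<not> x < y"
      using neg mem by (simp_all add: R_def)
    then obtain x y' x' y where 1: "x \<in> I u i" "y' \<in> I v' i" "\<not> x < y'"
      and 2: "x' \<in> I u' i" "y \<in> I v i" "\<not> x' < y" by blast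
    have "x < y" "x' < y'" using that 1 2 by (auto simp: R_def)
    then show False using 1 2 by linarith
  qed
  then have "\<exists>a b. (\<forall>v. a v \<le> n) \<and> (\<forall>u. 0 < b u \<and> b u \<le> n + 1) \<and> (\<forall>u v. R i u v \<longleftrightarrow> b u \<le> (a v :: nat))" for i
    by (intro interval_order_code) (auto simp: R_def)
  then obtain a b :: "nat \<Rightarrow> nat \<Rightarrow> nat" where a: "\<And>i v. a i v \<le> n"
    and b: "\<And>i u. 0 < b i u" "\<And>i u. b i u \<le> n + 1" and ab: "\<And>i u v. R i u v \<longleftrightarrow> b i u \<le> a i v"
    by metis
  have "\<exists>h. h ` bd v \<subseteq> {..<d} \<and> inj_on h (bd v)" if "v < n" for v
    using card_le_inj[OF fin_bd, of "{..<d}" v] card_bd[OF that] by simp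
  then obtain h where h: "\<And>v. v < n \<Longrightarrow> h v ` bd v \<subseteq> {..<d}" "\<And>v. v < n \<Longrightarrow> inj_on (h v) (bd v)"
    by metis
  have "card (\<Union>v<n. bd v) \<le> (\<Sum>v<n. card (bd v))" by (rule card_UN_le) simp
  also have "\<dots> \<le> of_nat (card {..<n}) * d" using card_bd by (intro sum_bounded_above) auto
  finally have "\<exists>g. g ` (\<Union>v<n. bd v) \<subseteq> {..<n * d} \<and> inj_on g (\<Union>v<n. bd v)"
    using card_le_inj[of "\<Union>v<n. bd v" "{..<n * d}"] fin_bd by simp
  then obtain g where g: "g ` (\<Union>v<n. bd v) \<subseteq> {..<n * d}" "inj_on g (\<Union>v<n. bd v)"
    by blast
  \<comment> \<open>An unused slot gets \<open>(0, 0, n + 1)\<close>, which is never before or after anything: \<open>a i v \<le> n\<close> and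
    \<open>0 < b i u\<close>.\<close>
  define c where "c = (\<lambda>(v, s). if v < n \<and> s < d then
      (if s \<in> h v ` bd v then let i = inv_into (bd v) (h v) s in (g i, a i v, b i v) else (0, 0, n + 1))
      else undefined)"
  have c_in: "c (v, h v i) = (g i, a i v, b i v)" if "v < n" "i \<in> bd v" for v i
    using h[OF that(1)] that by (auto simp: c_def Let_def)
  have c_out: "c (v, s) = (0, 0, n + 1)" if "v < n" "s < d" "s \<notin> h v ` bd v" for v s
    using that by (simp add: c_def)
  have "c \<in> codes n d"
    unfolding codes_def
  proof (rule PiE_I)
    fix x assume "x \<in> {..<n} \<times> {..<d}"
    then obtain v s where x: "x = (v, s)" "v < n" "s < d" by auto
    show "c x \<in> {..<n * d} \<times> {..<n + 2} \<times> {..<n + 2}"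
    proof (cases "s \<in> h v ` bd v")
      case True
      then obtain i where i: "i \<in> bd v" "s = h v i" by blast
      have "g i < n * d" using g(1) i x by blast
      then show ?thesis using c_in[OF x(2) i(1)] a[of i v] b(2)[of i v] x i by simp
    next
      case False
      then show ?thesis using c_out[OF x(2,3)] x by simp
    qed
  next
    fix x assume "x \<notin> {..<n} \<times> {..<d}"
    then show "c x = undefined" by (cases x) (auto simp: c_def)
  qed
  have before: "before_code d c u v \<longleftrightarrow> (\<exists>i. R i u v)" if uv: "u < n" "v < n" for u v
  proof
    assume "before_code d c u v"
    then obtain s t where st: "s < d" "t < d" "fst (c (u, s)) = fst (c (v, t))"
      "snd (snd (c (u, s))) \<le> fst (snd (c (v, t)))" unfolding before_code_def by blast
    have a_le: "fst (snd (c (v, t))) \<le> n"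
      using c_out[OF uv(2) st(2)] c_in[OF uv(2)] a by (cases "t \<in> h v ` bd v") auto
    have "s \<in> h u ` bd u"
      using c_out[OF uv(1) st(1)] a_le st(4) by fastforce
    then obtain i where i: "i \<in> bd u" "s = h u i" by blast
    have "t \<in> h v ` bd v"
      using c_out[OF uv(2) st(2)] c_in[OF uv(1) i(1)] i(2) b(1)[of i u] st(4) by fastforce
    then obtain j where j: "j \<in> bd v" "t = h v j" by blast
    have "g i = g j" using st(3) i j c_in uv by simp
    then have "i = j" using g(2) i(1) j(1) uv by (auto dest: inj_onD)
    then show "\<exists>i. R i u v" using st(4) i j c_in uv ab by auto
  next
    assume "\<exists>i. R i u v"
    then obtain i where i: "R i u v" by blast
    then have "i \<in> bd u" "i \<in> bd v" by (auto simp: R_def)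
    then show "before_code d c u v"
      unfolding before_code_def using h(1) uv c_in ab i
      by (intro exI[of _ "h u i"] conjI exI[of _ "h v i"]) auto
  qed
  have key: "{u, v} \<in> E \<longleftrightarrow> \<not> before_code d c u v \<and> \<not> before_code d c v u"
    if uv: "u < n" "v < n" "u \<noteq> v" for u v
  proof -
    have "I u i \<inter> I v i = {} \<longleftrightarrow> R i u v \<or> R i v u" if i: "i < d'" for i
    proof
      assume disj: "I u i \<inter> I v i = {}"
      have ne': "I u i \<noteq> {}" "I v i \<noteq> {}" using ne uv i by auto
      then have int: "is_interval (I u i)" "is_interval (I v i)" "bounded (I u i)" "bounded (I v i)"
        using ri[OF uv(1) i] ri[OF uv(2) i] disj by (auto simp: real_interval_def)
      then have bdi: "i \<in> bd u" "i \<in> bd v" using i by (auto simp: bd_def)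
      show "R i u v \<or> R i v u"
      proof (rule ccontr)
        assume neg: "\<not> (R i u v \<or> R i v u)"
        have "\<exists>x\<in>I u i. \<exists>y\<in>I v i. y \<le> x" "\<exists>x\<in>I u i. \<exists>y\<in>I v i. x \<le> y"
          using neg bdi uv by (auto simp: R_def not_less)
        then obtain x y x' y' where 1: "x \<in> I u i" "y \<in> I v i" "y \<le> x"
          and 2: "x' \<in> I u i" "y' \<in> I v i" "x' \<le> y'" by blast
        show False
        proof (cases "y \<le> x'")
          case True
          then have "x' \<in> I v i" using 1 2 int(2) by (meson mem_is_interval_1_I)
          then show False using 2 disj by blast
        next
          case False
          then have "y \<in> I u i" using 1 2 int(1) by (meson mem_is_interval_1_I linear)
          then show False using 1 disj by blast
        qed
      qed
    next
      assume "R i u v \<or> R i v u"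
      then show "I u i \<inter> I v i = {}" by (auto simp: R_def)
    qed
    moreover have "R i u v \<Longrightarrow> i < d'" "R i v u \<Longrightarrow> i < d'" for i by (auto simp: R_def bd_def)
    ultimately show ?thesis
      unfolding disjoint_iff[OF uv] before[OF uv(1,2)] before[OF uv(2,1)] by blast
  qed
  have "decode n d c = E"
  proof (intro set_eqI)
    fix e
    show "e \<in> decode n d c \<longleftrightarrow> e \<in> E"
    proof (cases "e \<in> all_edges {..<n}")
      case True
      then obtain u v where e: "e = {u, v}" "u < n" "v < n" "u \<noteq> v"
        by (auto simp: all_edges_def card_2_iff)
      have "e \<in> decode n d c \<longleftrightarrow> \<not> before_code d c u v \<and> \<not> before_code d c v u"
        using True unfolding decode_def e by (auto simp: doubleton_eq_iff)
      then show ?thesis using key[OF e(2-4)] e(1) by simp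
    next
      case False
      then show ?thesis using E by (auto simp: decode_def)
    qed
  qed
  then show ?thesis using \<open>c \<in> codes n d\<close> by blast
qed

lemma card_local_box_graphs_le:
  "card {E. E \<subseteq> all_edges {..<n} \<and> (\<exists>k\<le>d. has_local_box_rep {..<n} E k)} \<le> (n * d * (n + 2) ^ 2) ^ (n * d)"
proof -
  have "{E. E \<subseteq> all_edges {..<n} \<and> (\<exists>k\<le>d. has_local_box_rep {..<n} E k)} \<subseteq> decode n d ` codes n d"
    using ex_code by blast
  then have "card {E. E \<subseteq> all_edges {..<n} \<and> (\<exists>k\<le>d. has_local_box_rep {..<n} E k)} \<le> card (decode n d ` codes n d)"
    by (intro card_mono finite_imageI finite_codes)
  also have "\<dots> \<le> card (codes n d)" by (intro card_image_le finite_codes)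
  finally show ?thesis by (simp add: card_codes)
qed

section \<open>Tail bounds for the random graph\<close>

lemma finite_all_edges: "finite V \<Longrightarrow> finite (all_edges V)"
  by (rule finite_subset[of _ "Pow V"]) (auto simp: all_edges_def)

lemma card_all_edges: "finite V \<Longrightarrow> card (all_edges V) = card V choose 2"
  by (simp add: all_edges_def n_subsets)

lemma set_pmf_random_graph: "E \<in> set_pmf (random_graph n p) \<Longrightarrow> E \<subseteq> all_edges {..<n}"
  by (auto simp: random_graph_def)

lemma prob_random_graph_superset:
  assumes p: "0 \<le> p" "p \<le> 1" and A: "A \<subseteq> all_edges {..<n}"
  shows "measure_pmf.prob (random_graph n p) {E. A \<subseteq> E} = p ^ card A"
proof -
  let ?T = "all_edges {..<n}"
  have fin: "finite ?T" by (simp add: finite_all_edges)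
  have "(\<lambda>X. {e \<in> ?T. X e}) -` {E. A \<subseteq> E} = Pi ?T (\<lambda>e. if e \<in> A then {True} else UNIV)"
    using A by (auto simp: Pi_def)
  then have "measure_pmf.prob (random_graph n p) {E. A \<subseteq> E} =
      (\<Prod>e\<in>?T. measure_pmf.prob (bernoulli_pmf p) (if e \<in> A then {True} else UNIV))"
    using fin by (simp add: random_graph_def measure_Pi_pmf_Pi)
  also have "\<dots> = (\<Prod>e\<in>?T. if e \<in> A then p else 1)"
    using p by (intro prod.cong) (auto simp: measure_pmf_single)
  also have "\<dots> = p ^ card A"
    using fin A by (simp add: prod.If_cases Int_absorb1)
  finally show ?thesis .
qed

lemma power_le_exp_mult_fact:
  fixes x :: real
  assumes "0 \<le> x"
  shows "x ^ n \<le> exp x * fact n"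
proof -
  have "(\<Sum>k\<in>{n}. x ^ k /\<^sub>R fact k) \<le> (\<Sum>k. x ^ k /\<^sub>R fact k)"
    using assms by (intro sum_le_suminf summable_exp_generic) auto
  then have "x ^ n / fact n \<le> exp x"
    by (simp add: exp_def divide_inverse mult.commute)
  then show ?thesis by (simp add: field_simps)
qed

text \<open>\<open>m ^ m / fact m\<close> is one term of the series of \<open>exp m\<close>, which
  replaces Stirling's formula.\<close>

lemma choose_le_exp:
  assumes "0 < m"
  shows "real (N choose m) \<le> (exp 1 * N / m) ^ m"
proof -
  have "real m ^ m \<le> exp 1 ^ m * fact m"
    using power_le_exp_mult_fact[of "real m" m] by (simp add: exp_of_nat_mult[symmetric])
  moreover have "real (N choose m) * fact m \<le> real N ^ m"
    using binomial_fact_pow[of N m] by (metis of_nat_fact of_nat_le_iff of_nat_mult of_nat_power)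
  ultimately have "real (N choose m) * fact m * real m ^ m \<le> real N ^ m * (exp 1 ^ m * fact m)"
    by (intro mult_mono) auto
  then have "real (N choose m) * real m ^ m \<le> (exp 1 * N) ^ m"
    by (simp add: power_mult_distrib mult_ac)
  then show ?thesis
    using assms by (simp add: power_divide pos_le_divide_eq)
qed

text \<open>First moment: \<open>m\<close> edges inside \<open>T\<close> contain some
  \<open>m\<close>-subset of \<open>T\<close>, and each such subset is present with probability
  \<open>p ^ m\<close>.\<close>

lemma prob_many_edges_le:
  assumes p: "0 \<le> p" "p \<le> 1" and T: "T \<subseteq> all_edges {..<n}" and m: "0 < m"
  shows "measure_pmf.prob (random_graph n p) {E. m \<le> card (E \<inter> T)} \<le> (exp 1 * card T * p / m) ^ m"
proof -
  have finT: "finite T" using T finite_all_edges[of "{..<n}"] finite_subset by auto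
  define \<A> where "\<A> = {A. A \<subseteq> T \<and> card A = m}"
  have fin: "finite \<A>" unfolding \<A>_def using finT by simp
  have "{E. m \<le> card (E \<inter> T)} \<subseteq> (\<Union>A\<in>\<A>. {E. A \<subseteq> E})"
  proof
    fix E assume "E \<in> {E. m \<le> card (E \<inter> T)}"
    then obtain A where "A \<subseteq> E \<inter> T" "card A = m"
      using obtain_subset_with_card_n by (metis mem_Collect_eq)
    then show "E \<in> (\<Union>A\<in>\<A>. {E. A \<subseteq> E})" by (auto simp: \<A>_def)
  qed
  then have "measure_pmf.prob (random_graph n p) {E. m \<le> card (E \<inter> T)} \<le>
      measure_pmf.prob (random_graph n p) (\<Union>A\<in>\<A>. {E. A \<subseteq> E})"
    by (intro measure_pmf.finite_measure_mono) auto
  also have "\<dots> \<le> (\<Sum>A\<in>\<A>. measure_pmf.prob (random_graph n p) {E. A \<subseteq> E})"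
    using fin by (intro measure_pmf.finite_measure_subadditive_finite) auto
  also have "\<dots> = (\<Sum>A\<in>\<A>. p ^ m)"
    using T by (intro sum.cong) (auto simp: \<A>_def prob_random_graph_superset[OF p])
  also have "\<dots> = real (card T choose m) * p ^ m"
    using n_subsets[OF finT, of m] by (simp add: \<A>_def)
  also have "\<dots> \<le> (exp 1 * card T / m) ^ m * p ^ m"
    using choose_le_exp[OF m] p by (intro mult_right_mono) auto
  also have "\<dots> = (exp 1 * card T * p / m) ^ m"
    by (simp add: power_mult_distrib power_divide)
  finally show ?thesis .
qed

text \<open>Markov's inequality for \<open>(1/2) ^ card E\<close>, whose expectation factorises over
  the possible edges into factors \<open>1 - p / 2\<close>.\<close>

lemma prob_few_edges_le:
  fixes p x :: real
  assumes p: "0 \<le> p" "p \<le> 1"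
  shows "measure_pmf.prob (random_graph n p) {E. real (card E) < x} \<le> 2 powr x * exp (- real (n choose 2) * p / 2)"
proof -
  let ?T = "all_edges {..<n}"
  let ?M = "random_graph n p"
  have fin: "finite ?T" by (simp add: finite_all_edges)
  have ind: "integrable ?M (indicator {E. real (card E) < x} :: nat set set \<Rightarrow> real)"
    by (rule measure_pmf.integrable_const_bound[of _ 1]) (auto simp: indicator_def)
  have int: "integrable ?M (\<lambda>E. (1/2 :: real) ^ card E)"
    by (rule measure_pmf.integrable_const_bound[of _ 1]) (auto simp: power_le_one)
  have "measure_pmf.prob ?M {E. real (card E) < x} = measure_pmf.expectation ?M (indicator {E. real (card E) < x})"
    by simp
  also have "\<dots> \<le> measure_pmf.expectation ?M (\<lambda>E. 2 powr x * (1/2) ^ card E)"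
  proof (rule integral_mono)
    fix E
    have "1 \<le> 2 powr x * (1/2 :: real) ^ card E" if "real (card E) < x"
    proof -
      have "(2::real) ^ card E \<le> 2 powr x"
        using that powr_mono[of "real (card E)" x 2] by (simp add: powr_realpow)
      then show ?thesis by (simp add: power_one_over field_simps)
    qed
    then show "indicator {E. real (card E) < x} E \<le> 2 powr x * (1/2 :: real) ^ card E"
      by (auto simp: indicator_def)
  qed (use ind int in auto)
  also have "\<dots> = 2 powr x * measure_pmf.expectation ?M (\<lambda>E. (1/2) ^ card E)"
    by simp
  also have "measure_pmf.expectation ?M (\<lambda>E. (1/2 :: real) ^ card E) =
      measure_pmf.expectation (Pi_pmf ?T False (\<lambda>_. bernoulli_pmf p)) (\<lambda>X. \<Prod>e\<in>?T. if X e then 1/2 else 1)"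
    unfolding random_graph_def integral_map_pmf using fin
    by (intro Bochner_Integration.integral_cong) (auto simp: prod.If_cases Int_def)
  also have "\<dots> = (\<Prod>e\<in>?T. measure_pmf.expectation (bernoulli_pmf p) (\<lambda>b. if b then 1/2 else 1))"
    using fin by (intro expectation_prod_Pi_pmf) (auto intro!: integrable_measure_pmf_finite)
  also have "\<dots> = (1 - p / 2) ^ (n choose 2)"
    using p by (simp add: card_all_edges)
  also have "\<dots> \<le> exp (- p / 2) ^ (n choose 2)"
    using p exp_ge_add_one_self[of "- p / 2"] by (intro power_mono) auto
  also have "\<dots> = exp (- real (n choose 2) * p / 2)"
    by (simp add: exp_of_nat_mult[symmetric])
  finally show ?thesis by (simp add: mult_left_mono)
qed

section \<open>Lower bound for the random graph\<close>

text \<open>Either there are fewer than \<open>x\<close> edges, or the graph is one of the counted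
  ones with at least \<open>x\<close> edges. Weakening the event \<open>E = A\<close> to
  \<open>A \<subseteq> E\<close> leaves a plain power of \<open>p\<close>, with no factors for
  absent edges.\<close>

lemma prob_small_local_box_le:
  fixes p x :: real
  assumes p: "0 < p" "p \<le> 1" and x: "0 \<le> x"
  shows "measure_pmf.prob (random_graph n p) {E. E \<subseteq> all_edges {..<n} \<and> (\<exists>k\<le>d. has_local_box_rep {..<n} E k)}
     \<le> 2 powr x * exp (- real (n choose 2) * p / 2) + real ((n * d * (n + 2) ^ 2) ^ (n * d)) * p powr x"
proof -
  let ?M = "random_graph n p"
  define \<F> where "\<F> = {E. E \<subseteq> all_edges {..<n} \<and> (\<exists>k\<le>d. has_local_box_rep {..<n} E k)}"
  define \<G> where "\<G> = {E \<in> \<F>. x \<le> real (card E)}"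
  have fin\<F>: "finite \<F>"
  proof (rule finite_subset)
    show "\<F> \<subseteq> Pow (all_edges {..<n})" unfolding \<F>_def by blast
  qed (simp add: finite_all_edges)
  then have fin: "finite \<G>" by (simp add: \<G>_def)
  have "\<F> \<subseteq> {E. real (card E) < x} \<union> (\<Union>A\<in>\<G>. {E. A \<subseteq> E})"
    by (auto simp: \<G>_def not_less)
  then have "measure_pmf.prob ?M \<F> \<le> measure_pmf.prob ?M ({E. real (card E) < x} \<union> (\<Union>A\<in>\<G>. {E. A \<subseteq> E}))"
    by (intro measure_pmf.finite_measure_mono) auto
  also have "\<dots> \<le> measure_pmf.prob ?M {E. real (card E) < x} + measure_pmf.prob ?M (\<Union>A\<in>\<G>. {E. A \<subseteq> E})"
    by (rule measure_Un_le) auto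
  also have "measure_pmf.prob ?M (\<Union>A\<in>\<G>. {E. A \<subseteq> E}) \<le> (\<Sum>A\<in>\<G>. measure_pmf.prob ?M {E. A \<subseteq> E})"
    using fin by (intro measure_pmf.finite_measure_subadditive_finite) auto
  also have "\<dots> \<le> (\<Sum>A\<in>\<G>. p powr x)"
  proof (rule sum_mono)
    fix A assume A: "A \<in> \<G>"
    then have "measure_pmf.prob ?M {E. A \<subseteq> E} = p ^ card A"
      using p by (intro prob_random_graph_superset) (auto simp: \<G>_def \<F>_def)
    also have "\<dots> = p powr real (card A)" using p by (simp add: powr_realpow)
    also have "\<dots> \<le> p powr x" using A p by (intro powr_mono') (auto simp: \<G>_def)
    finally show "measure_pmf.prob ?M {E. A \<subseteq> E} \<le> p powr x" .
  qed
  also have "\<dots> = real (card \<G>) * p powr x" by simp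
  also have "real (card \<G>) \<le> real ((n * d * (n + 2) ^ 2) ^ (n * d))"
  proof -
    have "card \<G> \<le> card \<F>" using fin\<F> by (intro card_mono) (auto simp: \<G>_def)
    also have "\<dots> \<le> (n * d * (n + 2) ^ 2) ^ (n * d)" unfolding \<F>_def by (rule card_local_box_graphs_le)
    finally show ?thesis by (simp only: of_nat_le_iff)
  qed
  finally show ?thesis
    using prob_few_edges_le[of p n x] p unfolding \<F>_def by (simp add: mult_right_mono)
qed

text \<open>The count is at most \<open>exp (5 * n * d * ln n)\<close> with
  \<open>d \<le> \<epsilon> / 41 * a\<close>. It competes with \<open>p powr x\<close>, where
  \<open>x = (n - 1) * a / 6\<close> and \<open>ln p \<le> - \<epsilon> * ln n\<close>. Since 5/41 <
  1/6, the difference is negative, and from \<open>n = 41\<close> on it leaves at least the 1/25 of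
  the conclusion.\<close>

lemma prob_local_box_lower_le:
  fixes \<epsilon> p :: real
  assumes \<epsilon>: "0 < \<epsilon>" "\<epsilon> < 1" and n: "41 \<le> n"
    and np: "1 - \<epsilon> \<le> n * p" "n * p \<le> n powr (1 - \<epsilon>)"
  shows "measure_pmf.prob (random_graph n p)
      {E. E \<subseteq> all_edges {..<n} \<and> (\<exists>k\<le>nat \<lfloor>\<epsilon> / 41 * (n * p)\<rfloor>. has_local_box_rep {..<n} E k)}
     \<le> exp (- (1 - \<epsilon>) * (real n - 1) / 8) + exp (- \<epsilon> * (1 - \<epsilon>) * n * ln n / 25)"
proof -
  define a where "a = n * p"
  define d where "d = nat \<lfloor>\<epsilon> / 41 * a\<rfloor>"
  \<comment> \<open>A third of the expected number of edges: \<open>x * ln 2 - 3 / 2 * x\<close> is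
    then at most \<open>- 3 / 4 * x\<close>, so having fewer edges is exponentially
    unlikely.\<close>
  define x where "x = real (n choose 2) * p / 3"
  have a: "1 - \<epsilon> \<le> a" "a \<le> n powr (1 - \<epsilon>)" "0 < a" using np \<epsilon> by (simp_all add: a_def)
  have p: "0 < p" using a(3) n by (simp add: a_def zero_less_mult_iff)
  have ln_n: "0 < ln (real n)" using n by simp
  have "ln a \<le> (1 - \<epsilon>) * ln n"
    using ln_le_cancel_iff[of a "n powr (1 - \<epsilon>)"] a n by (simp add: ln_powr)
  then have ln_p: "ln p \<le> - \<epsilon> * ln n"
    using n p by (simp add: a_def ln_mult algebra_simps)
  have "ln p \<le> 0" using ln_p \<epsilon> ln_n by (smt (verit) mult_minus_left mult_nonneg_nonneg)
  then have p1: "p \<le> 1" using p by simp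
  have choose: "real (n choose 2) = n * (real n - 1) / 2"
    using n by (simp add: choose_two real_of_nat_div of_nat_diff)
  have x: "x = (real n - 1) * a / 6" by (simp add: x_def choose a_def)
  have x0: "0 \<le> x"
    unfolding x using a n by (intro divide_nonneg_nonneg mult_nonneg_nonneg) auto
  have a_le: "a \<le> n"
  proof -
    have "a \<le> real n powr (1 - \<epsilon>)" by (rule a)
    also have "\<dots> \<le> real n powr 1" using n \<epsilon> by (intro powr_mono) auto
    finally show ?thesis using n by simp
  qed
  have d_le: "real d \<le> \<epsilon> / 41 * a"
    unfolding d_def using \<epsilon> a by (intro of_nat_floor) simp
  have "\<epsilon> / 41 * a \<le> 1 * a" using \<epsilon> a by (intro mult_right_mono) auto
  then have "real d \<le> n" using d_le a_le by linarith
  then have d_n: "d \<le> n" by simp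
  have "2 powr x * exp (- real (n choose 2) * p / 2) = exp (x * ln 2 - 3 / 2 * x)"
    by (simp add: powr_def exp_add[symmetric] x_def)
  also have "\<dots> \<le> exp (- (1 - \<epsilon>) * (real n - 1) / 8)"
  proof -
    have "x * ln 2 \<le> x * (3 / 4)" using x0 ln2_le_25_over_36 by (intro mult_left_mono) auto
    moreover have "x * 6 \<ge> (1 - \<epsilon>) * (real n - 1)"
      unfolding x using a n by (simp add: mult.commute mult_left_mono)
    ultimately have "x * ln 2 - 3 / 2 * x \<le> - ((1 - \<epsilon>) * (real n - 1)) / 8" by linarith
    then show ?thesis by (simp only: exp_le_cancel_iff minus_mult_left)
  qed
  finally have 1: "2 powr x * exp (- real (n choose 2) * p / 2) \<le> exp (- (1 - \<epsilon>) * (real n - 1) / 8)" .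
  have "n * d * (n + 2) ^ 2 \<le> n * n * n ^ 3"
  proof (intro mult_mono d_n order_refl)
    have "(n + 2)^2 \<le> (2 * n) ^ 2" using n by (intro power_mono) auto
    also have "\<dots> = 4 * n ^ 2" by (simp add: power_mult_distrib)
    also have "\<dots> \<le> n * n ^ 2" using n by (intro mult_right_mono) auto
    finally show "(n + 2)^2 \<le> n ^ 3" by (simp add: power3_eq_cube power2_eq_square)
  qed auto
  then have "n * d * (n + 2) ^ 2 \<le> n ^ 5" by (simp add: numeral_eq_Suc mult_ac)
  then have "(n * d * (n + 2) ^ 2) ^ (n * d) \<le> (n ^ 5) ^ (n * d)" by (intro power_mono) auto
  also have "\<dots> = n ^ (5 * (n * d))" by (simp add: power_mult)
  finally have "real ((n * d * (n + 2) ^ 2) ^ (n * d)) \<le> real (n ^ (5 * (n * d)))" by (simp only: of_nat_le_iff)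
  also have "\<dots> = exp (5 * (n * real d) * ln n)"
    using n by (simp add: powr_realpow[symmetric] powr_def)
  finally have M: "real ((n * d * (n + 2) ^ 2) ^ (n * d)) \<le> exp (5 * (n * real d) * ln n)" .
  have "real ((n * d * (n + 2) ^ 2) ^ (n * d)) * p powr x \<le> exp (5 * (n * real d) * ln n) * exp (x * ln p)"
    using M p by (intro mult_mono) (auto simp: powr_def)
  also have "\<dots> = exp (5 * (n * real d) * ln n + x * ln p)" by (simp add: exp_add)
  also have "\<dots> \<le> exp (- \<epsilon> * (1 - \<epsilon>) * n * ln n / 25)"
  proof -
    have "5 * (n * real d) * ln n \<le> 5 * (n * (\<epsilon> / 41 * a)) * ln n"
      using d_le ln_n by (intro mult_right_mono mult_left_mono) auto
    moreover have "x * ln p \<le> x * (- \<epsilon> * ln n)" using x0 ln_p by (rule mult_left_mono[rotated])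
    ultimately have "5 * (n * real d) * ln n + x * ln p \<le> 5 * (n * (\<epsilon> / 41 * a)) * ln n + x * (- \<epsilon> * ln n)"
      by (rule add_mono)
    also have "\<dots> = (\<epsilon> * a * ln n) * (5 * real n / 41 - (real n - 1) / 6)"
      unfolding x by (simp add: field_simps)
    also have "\<dots> \<le> (\<epsilon> * a * ln n) * (- real n / 25)"
    proof (rule mult_left_mono)
      have "41 \<le> real n" using n by simp
      then show "5 * real n / 41 - (real n - 1) / 6 \<le> - real n / 25" by (simp add: field_simps)
    qed (use \<epsilon> a ln_n in simp)
    also have "\<dots> = - (a * (\<epsilon> * n * ln n / 25))" by simp
    also have "\<dots> \<le> - ((1 - \<epsilon>) * (\<epsilon> * n * ln n / 25))"
      using \<epsilon> a ln_n by (intro le_imp_neg_le mult_right_mono) auto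
    finally show ?thesis by (simp add: mult_ac)
  qed
  finally have 2: "real ((n * d * (n + 2) ^ 2) ^ (n * d)) * p powr x \<le> exp (- \<epsilon> * (1 - \<epsilon>) * n * ln n / 25)" .
  show ?thesis
    using prob_small_local_box_le[OF p p1 x0, of n d] 1 2 unfolding d_def a_def by linarith
qed

section \<open>Upper bound for the random graph\<close>

definition touching :: "nat \<Rightarrow> nat set \<Rightarrow> nat set set" where
  "touching n S = {e \<in> all_edges {..<n}. e \<inter> S \<noteq> {}}"

lemma touching_subset: "touching n S \<subseteq> all_edges {..<n}"
  by (auto simp: touching_def)

lemma card_touching_le: "finite S \<Longrightarrow> card (touching n S) \<le> card S * n"
proof -
  assume fin: "finite S"
  have "touching n S \<subseteq> (\<lambda>(v, u). {v, u}) ` (S \<times> {..<n})"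
  proof
    fix e assume "e \<in> touching n S"
    then obtain x y where xy: "e = {x, y}" "x < n" "y < n" "x \<in> S \<or> y \<in> S"
      by (auto simp: touching_def all_edges_def card_2_iff)
    then have "e = (\<lambda>(v, u). {v, u}) (x, y)" "e = (\<lambda>(v, u). {v, u}) (y, x)" by auto
    then show "e \<in> (\<lambda>(v, u). {v, u}) ` (S \<times> {..<n})"
      using xy by (metis SigmaI imageI lessThan_iff)
  qed
  then have "card (touching n S) \<le> card ((\<lambda>(v, u). {v, u}) ` (S \<times> {..<n}))"
    using fin by (intro card_mono) auto
  also have "\<dots> \<le> card (S \<times> {..<n})" using fin by (intro card_image_le) auto
  finally show ?thesis by (simp add: card_cartesian_product)
qed

text \<open>Ordered pairs inject into pairs of an edge and one of its ends. The sets
  \<open>U\<close> and \<open>F\<close> are free because the lemma serves for the edges touching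
  \<open>S\<close> as well as for the edges inside \<open>S\<close>.\<close>

lemma sum_degrees_le:
  assumes "finite S" "finite U" "finite F" "\<And>e. e \<in> F \<Longrightarrow> card e = 2"
    and "\<And>u v. v \<in> S \<Longrightarrow> u \<in> U \<Longrightarrow> {v, u} \<in> E \<Longrightarrow> {v, u} \<in> F"
  shows "(\<Sum>v\<in>S. card {u \<in> U. {v, u} \<in> E}) \<le> 2 * card F"
proof -
  have finF: "finite e" if "e \<in> F" for e using assms(4)[OF that] card.infinite by fastforce
  have "(\<Sum>v\<in>S. card {u \<in> U. {v, u} \<in> E}) = card (SIGMA v:S. {u \<in> U. {v, u} \<in> E})"
    using assms by simp
  also have "\<dots> = card ((\<lambda>(v, u). ({v, u}, v)) ` (SIGMA v:S. {u \<in> U. {v, u} \<in> E}))"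
    by (rule card_image[symmetric]) (auto intro!: inj_onI simp: doubleton_eq_iff)
  also have "\<dots> \<le> card (SIGMA e:F. e)"
    using assms finF by (intro card_mono finite_SigmaI) auto
  also have "\<dots> = (\<Sum>e\<in>F. card e)" using assms finF by simp
  also have "\<dots> = 2 * card F" using assms(4) by simp
  finally show ?thesis .
qed

text \<open>\<open>A\<close> leaves fewer than \<open>k\<close> vertices of degree above
  \<open>16 * d\<close>, as \<open>k\<close> of them would have degree sum at least
  \<open>16 * k * d\<close>. It also bounds the size of their closed neighbourhood by
  \<open>17 * k * d\<close>, so that \<open>B\<close> makes it sparse. For \<open>k = 1\<close>
  there are no vertices of high degree, hence the premise \<open>1 < k\<close>.\<close>

lemma has_local_box_rep_if_sparse:
  assumes E: "E \<subseteq> all_edges {..<n}" and d: "1 \<le> d" and k: "1 \<le> k" "k \<le> n"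
    and A: "\<And>S. S \<subseteq> {..<n} \<Longrightarrow> card S = k \<Longrightarrow> card (E \<inter> touching n S) < 8 * k * d"
    and B: "\<And>S. 1 < k \<Longrightarrow> S \<subseteq> {..<n} \<Longrightarrow> S \<noteq> {} \<Longrightarrow> card S \<le> 17 * k * d \<Longrightarrow>
              8 * card (E \<inter> all_edges S) < 9 * card S"
  shows "has_local_box_rep {..<n} E (8 * (16 * d) + 15)"
proof -
  have card2: "card e = 2" if "e \<in> E" for e using E that by (auto simp: all_edges_def)
  have finE: "finite E" using E finite_all_edges[of "{..<n}"] finite_subset by auto
  define adj where "adj = (\<lambda>u v. {u, v} \<in> E)"
  have sym: "adj v u" if "adj u v" for u v using that by (simp add: adj_def insert_commute)
  have irr: "\<not> adj v v" for v using card2[of "{v}"] by (auto simp: adj_def)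
  define X where "X = {v \<in> {..<n}. 16 * d < card {u \<in> {..<n}. adj v u}}"
  have finX: "finite X" by (simp add: X_def)
  have cardX: "card X < k"
  proof (rule ccontr)
    assume "\<not> card X < k"
    then obtain S where S: "S \<subseteq> X" "card S = k" "finite S"
      using obtain_subset_with_card_n[of k X] by auto
    have "of_nat (card S) * (16 * d) \<le> (\<Sum>v\<in>S. card {u \<in> {..<n}. {v, u} \<in> E})"
      using S by (intro sum_bounded_below) (auto simp: X_def adj_def)
    also have "\<dots> \<le> 2 * card (E \<inter> touching n S)"
      using S finE E by (intro sum_degrees_le) (auto simp: card2 touching_def)
    also have "\<dots> < 2 * (8 * k * d)"
      using A[of S] S X_def by (intro mult_strict_left_mono) auto
    finally show False using S by simp
  qed
  have sparse: "4 * (\<Sum>v\<in>S. card {u \<in> S. adj v u}) < 9 * card S"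
    if S: "S \<subseteq> X \<union> {u \<in> {..<n}. \<exists>x\<in>X. adj x u}" "S \<noteq> {}" for S
  proof -
    have "X \<noteq> {}" using S by auto
    then have k1: "1 < k" using cardX finX by (metis card_gt_0_iff less_one linorder_neqE_nat not_less_iff_gr_or_eq)
    have sub: "X \<subseteq> {..<n}" by (auto simp: X_def)
    \<comment> \<open>\<open>A\<close> speaks only of sets of exactly \<open>k\<close> vertices, so
      \<open>X\<close> is padded by \<open>Y\<close>.\<close>
    have "k - card X \<le> card ({..<n} - X)"
      using k finX sub by (simp add: card_Diff_subset)
    then obtain Y where Y: "Y \<subseteq> {..<n} - X" "card Y = k - card X" "finite Y"
      by (rule obtain_subset_with_card_n)
    define Z where "Z = X \<union> Y"
    have cardZ: "card Z = k" using Y cardX finX by (subst Z_def, subst card_Un_disjoint) auto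
    have subZ: "Z \<subseteq> {..<n}" using Y sub by (auto simp: Z_def)
    have finZ: "finite Z" using subZ finite_subset by blast
    have fint: "finite (E \<inter> touching n Z)" using finE by simp
    have "S \<subseteq> Z \<union> \<Union>(E \<inter> touching n Z)"
    proof
      fix u assume "u \<in> S"
      then consider "u \<in> X" | x where "x \<in> X" "adj x u" using S by blast
      then show "u \<in> Z \<union> \<Union>(E \<inter> touching n Z)"
      proof cases
        case 1
        then show ?thesis by (simp add: Z_def)
      next
        case (2 x)
        then have "{x, u} \<in> E \<inter> touching n Z" using E by (auto simp: adj_def touching_def Z_def)
        then show ?thesis by blast
      qed
    qed
    moreover have fin2: "finite (\<Union>(E \<inter> touching n Z))"
      using fint card2 by (intro finite_Union) (auto intro: card_ge_0_finite)
    ultimately have "card S \<le> card (Z \<union> \<Union>(E \<inter> touching n Z))"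
      using finZ by (intro card_mono) auto
    also have "\<dots> \<le> card Z + card (\<Union>(E \<inter> touching n Z))" by (rule card_Un_le)
    also have "card (\<Union>(E \<inter> touching n Z)) \<le> (\<Sum>e\<in>E \<inter> touching n Z. card e)"
      using fint by (intro card_Union_le_sum_card)
    also have "\<dots> = 2 * card (E \<inter> touching n Z)" using card2 by simp
    also have "\<dots> \<le> 2 * (8 * k * d)" using A[OF subZ cardZ] by (intro mult_le_mono2 less_imp_le)
    finally have "card S \<le> k + 16 * k * d" using cardZ by simp
    also have "\<dots> \<le> 17 * k * d" using d by simp
    finally have cS: "card S \<le> 17 * k * d" .
    have S_sub: "S \<subseteq> {..<n}" using S sub by auto
    have finS: "finite S" using S_sub finite_subset by blast
    have "(\<Sum>v\<in>S. card {u \<in> S. {v, u} \<in> E}) \<le> 2 * card (E \<inter> all_edges S)"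
      using finS finE by (intro sum_degrees_le) (auto simp: card2 all_edges_def)
    then show ?thesis using B[OF k1 S_sub S(2) cS] by (simp add: adj_def)
  qed
  have "separable {..<n} adj (\<lambda>u v. u \<noteq> v \<and> \<not> adj u v) (\<lambda>_. 8 * (16 * d) + 15)"
    by (rule separable_high_degree[where X = X]) (use sym irr sparse in \<open>auto simp: X_def not_less\<close>)
  then show ?thesis unfolding adj_def by (rule has_local_box_rep_if_separable)
qed

text \<open>Union bound: \<open>n \<le> k * exp d\<close> bounds the number of sets by
  \<open>exp (k * (1 + d))\<close>, while each fails with probability at most
  \<open>exp (- 8 * k * d)\<close>. The factor 8 works because \<open>exp 2 \<le> 8\<close> makes
  \<open>exp 1 * (k * d) / (8 * k * d)\<close> at most \<open>exp (- 1)\<close>.\<close>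

lemma prob_touching_le:
  fixes p :: real
  assumes p: "0 \<le> p" "p \<le> 1" "n * p \<le> d" and d: "1 \<le> d" and k: "1 \<le> k" "n \<le> k * exp d"
  shows "measure_pmf.prob (random_graph n p)
     {E. \<exists>S\<subseteq>{..<n}. card S = k \<and> 8 * k * d \<le> card (E \<inter> touching n S)} \<le> exp (- 6 * real k * d)"
proof -
  let ?M = "random_graph n p"
  let ?m = "8 * k * d"
  define \<S> where "\<S> = {S. S \<subseteq> {..<n} \<and> card S = k}"
  have fin: "finite \<S>" by (simp add: \<S>_def)
  have m: "0 < ?m" using d k by simp
  have each: "measure_pmf.prob ?M {E. ?m \<le> card (E \<inter> touching n S)} \<le> exp (- real ?m)" if S: "S \<in> \<S>" for S
  proof -
    have "card (touching n S) \<le> k * n"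
      using S card_touching_le[of S n] finite_subset[of S "{..<n}"] by (auto simp: \<S>_def)
    then have "real (card (touching n S)) * p \<le> real (k * n) * p"
      using p(1) by (intro mult_right_mono of_nat_mono)
    also have "\<dots> = k * (n * p)" by simp
    also have "\<dots> \<le> k * real d" using p(3) by (rule mult_left_mono) simp
    finally have "exp 1 * (card (touching n S) * p) \<le> exp 1 * (k * real d)" by (rule mult_left_mono) simp
    moreover have "exp 1 * exp 1 \<le> (8::real)"
      using mult_mono[of "exp 1 :: real" "272/100" "exp 1" "272/100"] e_less_272 by auto
    then have "exp 1 * (k * real d) \<le> 8 * (k * real d) * exp (- 1)"
      using d k by (simp add: exp_minus field_simps)
    ultimately have "exp 1 * (card (touching n S) * p) \<le> 8 * (k * real d) * exp (- 1)"
      by (rule order_trans)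
    then have "exp 1 * card (touching n S) * p \<le> exp (- 1) * real ?m"
      by (simp only: of_nat_mult of_nat_numeral mult_ac)
    then have "exp 1 * card (touching n S) * p / ?m \<le> exp (- 1)"
      using m by (subst pos_divide_le_eq) auto
    then have "(exp 1 * card (touching n S) * p / ?m) ^ ?m \<le> exp (- 1) ^ ?m"
      using p by (intro power_mono) auto
    also have "\<dots> = exp (- real ?m)" by (simp add: exp_of_nat_mult[symmetric])
    finally show ?thesis
      using prob_many_edges_le[OF p(1,2) touching_subset m, of n S] by linarith
  qed
  have "{E. \<exists>S\<subseteq>{..<n}. card S = k \<and> ?m \<le> card (E \<inter> touching n S)} =
      (\<Union>S\<in>\<S>. {E. ?m \<le> card (E \<inter> touching n S)})"
    by (auto simp: \<S>_def)
  then have "measure_pmf.prob ?M {E. \<exists>S\<subseteq>{..<n}. card S = k \<and> ?m \<le> card (E \<inter> touching n S)}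
     \<le> (\<Sum>S\<in>\<S>. measure_pmf.prob ?M {E. ?m \<le> card (E \<inter> touching n S)})"
    using measure_pmf.finite_measure_subadditive_finite[OF fin, of "\<lambda>S. {E. ?m \<le> card (E \<inter> touching n S)}" ?M]
    by simp
  also have "\<dots> \<le> (\<Sum>S\<in>\<S>. exp (- real ?m))" by (intro sum_mono each)
  also have "\<dots> = real (n choose k) * exp (- real ?m)"
    by (simp add: \<S>_def n_subsets)
  also have "\<dots> \<le> exp (k * (1 + real d)) * exp (- real ?m)"
  proof (rule mult_right_mono)
    have "real (n choose k) \<le> (exp 1 * n / k) ^ k" using k by (intro choose_le_exp) simp
    also have "\<dots> \<le> (exp (1 + real d)) ^ k"
      using k by (intro power_mono) (simp_all add: exp_add field_simps)
    also have "\<dots> = exp (k * (1 + real d))" by (simp add: exp_of_nat_mult)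
    finally show "real (n choose k) \<le> exp (k * (1 + real d))" .
  qed simp
  also have "\<dots> = exp (k * (1 + real d) - 8 * k * d)" by (simp add: exp_diff exp_minus divide_inverse)
  also have "\<dots> \<le> exp (- 6 * real k * d)"
  proof -
    have "real k * 1 \<le> real k * d" using d by (intro mult_left_mono) auto
    then show ?thesis by (simp add: algebra_simps)
  qed
  finally show ?thesis .
qed

lemma sum_Suc_half_power_le: "(\<Sum>j<J. real (Suc j) * (1 / 2) ^ j) \<le> 4"
proof -
  have "(\<Sum>j<J. real (Suc j) * (1 / 2) ^ j) = 4 - (2 * real J + 4) * (1 / 2) ^ J"
  proof (induction J)
    case (Suc J)
    define h where "h = (1 / 2 :: real) ^ J"
    show ?case using Suc by (simp add: h_def[symmetric] algebra_simps)
  qed simp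
  then show ?thesis by simp
qed

text \<open>With \<open>x = 2 * j * d / n\<close> the edges contribute at most
  \<open>x powr (9/8 * j)\<close>. One power of \<open>x\<close> per vertex cancels
  \<open>n / j\<close> from the choice of the set and leaves \<open>2 * exp 1 * d\<close>; the
  excess of 9/8 over 1 supplies the small factor \<open>x powr (1/8)\<close>.\<close>

lemma dense_subset_term_le:
  fixes p :: real
  assumes p: "0 \<le> p" "n * p \<le> d" and d: "1 \<le> d" and j: "1 \<le> j" "j \<le> n"
    and half: "2 * exp 1 * real d * (2 * real j * d / n) powr (1 / 8) \<le> 1 / 2"
    and m: "9 * j \<le> 8 * m"
  shows "real (n choose j) * (exp 1 * (j choose 2) * p / m) ^ m
      \<le> 2 * exp 1 * d * (2 * real d / n) powr (1 / 8) * (j * (1 / 2) ^ (j - 1))"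
proof -
  \<comment> \<open>The factor 2 is generous: \<open>exp 1 < 3\<close>,
    \<open>j choose 2 \<le> j ^ 2 / 2\<close> and \<open>j \<le> 8/9 * m\<close> give 4/3.\<close>
  define x where "x = 2 * real j * d / n"
  define b where "b = 2 * exp 1 * real d * x powr (1 / 8)"
  have pos: "0 < real j" "0 < real n" "0 < real d" "0 < real m" using j d m by auto
  then have x_pos: "0 < x" by (simp add: x_def)
  have b_half: "b \<le> 1 / 2" using half by (simp add: b_def x_def)
  have b0: "0 \<le> b" by (simp add: b_def)
  have x1: "x \<le> 1"
  proof (rule ccontr)
    assume "\<not> x \<le> 1"
    then have "1 \<le> x powr (1 / 8)" by (intro ge_one_powr_ge_zero) auto
    then have "1 * 1 * 1 \<le> exp 1 * real d * x powr (1 / 8)"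
      using d by (intro mult_mono) auto
    then show False using b_half by (simp add: b_def)
  qed
  have "exp 1 * (j choose 2) * p / m \<le> x"
  proof -
    have "real (j choose 2) = real j * (real j - 1) / 2"
      using j by (simp add: choose_two real_of_nat_div of_nat_diff)
    also have "\<dots> \<le> real j * real j / 2" by (simp add: mult_left_mono)
    finally have "exp 1 * (j choose 2) * p \<le> 3 * (real j * real j / 2) * p"
      using p e_less_272 by (intro mult_right_mono mult_mono) auto
    also have "\<dots> = 3 / 2 * real j * (real j * p)" by simp
    also have "\<dots> \<le> 3 / 2 * (8 / 9 * m) * (real j * p)"
      using m p by (intro mult_right_mono mult_left_mono) auto
    also have "\<dots> \<le> 2 * m * (real j * p)" using p by (simp add: mult_right_mono)
    also have "\<dots> \<le> 2 * m * (real j * (d / n))"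
      using p pos by (intro mult_left_mono) (auto simp: field_simps)
    also have "\<dots> = x * m" by (simp add: x_def)
    finally show ?thesis using pos by (simp add: pos_divide_le_eq)
  qed
  then have "(exp 1 * (j choose 2) * p / m) ^ m \<le> x ^ m"
    using p by (intro power_mono) auto
  also have "\<dots> = x powr m" using x_pos by (simp add: powr_realpow)
  also have "\<dots> \<le> x powr (9 / 8 * j)"
    using m x1 x_pos by (intro powr_mono') auto
  also have "\<dots> = (x powr (1 + 1 / 8)) powr j" by (simp add: powr_powr)
  also have "\<dots> = (x powr (1 + 1 / 8)) ^ j" using x_pos by (simp add: powr_realpow)
  also have "\<dots> = (x * x powr (1 / 8)) ^ j" unfolding powr_add using x_pos by simp
  finally have 1: "(exp 1 * (j choose 2) * p / m) ^ m \<le> (x * x powr (1 / 8)) ^ j" .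
  have "real (n choose j) * (exp 1 * (j choose 2) * p / m) ^ m \<le> (exp 1 * n / j) ^ j * (x * x powr (1 / 8)) ^ j"
    using 1 choose_le_exp[of j n] j p by (intro mult_mono) auto
  also have "\<dots> = (exp 1 * n / j * x * x powr (1 / 8)) ^ j" by (simp only: power_mult_distrib[symmetric] mult.assoc)
  also have "exp 1 * n / j * x = 2 * exp 1 * d" using pos by (simp add: x_def)
  also have "(2 * exp 1 * d * x powr (1 / 8)) ^ j = b ^ j" by (simp add: b_def)
  \<comment> \<open>One factor \<open>b\<close> is kept for the decay in \<open>n\<close>; the
    others become powers of 1/2, summable over \<open>j\<close>.\<close>
  also have "b ^ j = b * b ^ (j - 1)" using j by (cases j) auto
  also have "\<dots> \<le> b * (1 / 2) ^ (j - 1)"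
    using b0 b_half by (intro mult_left_mono power_mono)
  also have "\<dots> \<le> 2 * exp 1 * d * ((2 * real d / n) powr (1 / 8) * j) * (1 / 2) ^ (j - 1)"
    unfolding b_def
  proof (intro mult_right_mono mult_left_mono)
    have "x powr (1 / 8) = (2 * real d / n) powr (1 / 8) * real j powr (1 / 8)"
      using pos by (simp add: x_def powr_mult[symmetric] field_simps)
    also have "\<dots> \<le> (2 * real d / n) powr (1 / 8) * real j powr 1"
      using j by (intro mult_left_mono powr_mono) auto
    finally show "x powr (1 / 8) \<le> (2 * real d / n) powr (1 / 8) * j" using j by simp
  qed auto
  finally show ?thesis by (simp add: mult_ac)
qed

lemma prob_dense_subset_le:
  fixes p :: real
  assumes p: "0 \<le> p" "p \<le> 1" "n * p \<le> d" and d: "1 \<le> d" and n: "1 \<le> n"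
    and half: "2 * exp 1 * real d * (2 * real s * d / n) powr (1 / 8) \<le> 1 / 2"
  shows "measure_pmf.prob (random_graph n p)
     {E. \<exists>S\<subseteq>{..<n}. S \<noteq> {} \<and> card S \<le> s \<and> 9 * card S \<le> 8 * card (E \<inter> all_edges S)}
     \<le> 8 * exp 1 * d * (2 * real d / n) powr (1 / 8)"
proof -
  let ?M = "random_graph n p"
  \<comment> \<open>The summand 7 rounds up: \<open>m j\<close> is the least number of edges that
    violates sparsity on \<open>j\<close> vertices.\<close>
  define m where "m = (\<lambda>j::nat. (9 * j + 7) div 8)"
  define \<S> where "\<S> = {S. S \<subseteq> {..<n} \<and> S \<noteq> {} \<and> card S \<le> s}"
  define B where "B = (\<lambda>S::nat set. {E. m (card S) \<le> card (E \<inter> all_edges S)})"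
  define t where "t = (\<lambda>j. (exp 1 * (j choose 2) * p / m j) ^ m j)"
  have fin: "finite \<S>" unfolding \<S>_def by simp
  have t0: "0 \<le> t j" for j using p by (simp add: t_def)
  have "{E. \<exists>S\<subseteq>{..<n}. S \<noteq> {} \<and> card S \<le> s \<and> 9 * card S \<le> 8 * card (E \<inter> all_edges S)}
     \<subseteq> (\<Union>S\<in>\<S>. B S)"
  proof
    fix E assume "E \<in> {E. \<exists>S\<subseteq>{..<n}. S \<noteq> {} \<and> card S \<le> s \<and> 9 * card S \<le> 8 * card (E \<inter> all_edges S)}"
    then obtain S where S: "S \<in> \<S>" "9 * card S \<le> 8 * card (E \<inter> all_edges S)" by (auto simp: \<S>_def)
    have "m (card S) \<le> (8 * card (E \<inter> all_edges S) + 7) div 8"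
      unfolding m_def using S(2) by (intro div_le_mono) simp
    then have "E \<in> B S" by (simp add: B_def)
    then show "E \<in> (\<Union>S\<in>\<S>. B S)" using S(1) by blast
  qed
  then have "measure_pmf.prob ?M {E. \<exists>S\<subseteq>{..<n}. S \<noteq> {} \<and> card S \<le> s \<and> 9 * card S \<le> 8 * card (E \<inter> all_edges S)}
    \<le> measure_pmf.prob ?M (\<Union>S\<in>\<S>. B S)"
    by (intro measure_pmf.finite_measure_mono) auto
  also have "\<dots> \<le> (\<Sum>S\<in>\<S>. measure_pmf.prob ?M (B S))"
    using fin by (intro measure_pmf.finite_measure_subadditive_finite) auto
  also have "\<dots> \<le> (\<Sum>S\<in>\<S>. t (card S))"
  proof (rule sum_mono)
    fix S assume S: "S \<in> \<S>"
    have finS: "finite S" using S finite_subset by (auto simp: \<S>_def)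
    then have "card S \<noteq> 0" using S by (auto simp: \<S>_def)
    then have "0 < m (card S)" by (simp add: m_def)
    moreover have "all_edges S \<subseteq> all_edges {..<n}" using S by (auto simp: \<S>_def all_edges_def)
    ultimately show "measure_pmf.prob ?M (B S) \<le> t (card S)"
      using prob_many_edges_le[OF p(1,2), of "all_edges S" n "m (card S)"] finS
      by (simp add: B_def t_def card_all_edges)
  qed
  also have "\<dots> = (\<Sum>j=1..min s n. (\<Sum>S\<in>{S \<in> \<S>. card S = j}. t (card S)))"
  proof (rule sum.group[symmetric])
    show "card ` \<S> \<subseteq> {1..min s n}"
    proof
      fix j assume "j \<in> card ` \<S>"
      then obtain S where S: "j = card S" "S \<subseteq> {..<n}" "S \<noteq> {}" "card S \<le> s" by (auto simp: \<S>_def)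
      have "finite S" using S(2) finite_subset by blast
      then have "card S \<noteq> 0" using S(3) by simp
      moreover have "card S \<le> n" using card_mono[OF _ S(2)] by simp
      ultimately show "j \<in> {1..min s n}" using S by simp
    qed
  qed (use fin in auto)
  also have "\<dots> \<le> (\<Sum>j=1..min s n. real (n choose j) * t j)"
  proof (rule sum_mono)
    fix j assume "j \<in> {1..min s n}"
    have "{S \<in> \<S>. card S = j} \<subseteq> {S. S \<subseteq> {..<n} \<and> card S = j}" by (auto simp: \<S>_def)
    then have "card {S \<in> \<S>. card S = j} \<le> card {S. S \<subseteq> {..<n} \<and> card S = j}"
      by (intro card_mono) auto
    also have "\<dots> = n choose j" by (simp add: n_subsets)
    finally show "(\<Sum>S\<in>{S \<in> \<S>. card S = j}. t (card S)) \<le> real (n choose j) * t j"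
      using t0 by (simp add: mult_right_mono)
  qed
  also have "\<dots> \<le> (\<Sum>j=1..min s n. 2 * exp 1 * d * (2 * real d / n) powr (1 / 8) * (j * (1 / 2) ^ (j - 1)))"
  proof (rule sum_mono)
    fix j assume j: "j \<in> {1..min s n}"
    have "(2 * real j * d / n) powr (1 / 8) \<le> (2 * real s * d / n) powr (1 / 8)"
      using j by (intro powr_mono2 divide_right_mono mult_right_mono mult_left_mono) auto
    then have "2 * exp 1 * real d * (2 * real j * d / n) powr (1 / 8) \<le> 1 / 2"
      by (intro order_trans[OF mult_left_mono half]) auto
    then show "real (n choose j) * t j \<le> 2 * exp 1 * d * (2 * real d / n) powr (1 / 8) * (j * (1 / 2) ^ (j - 1))"
      unfolding t_def using p d j by (intro dense_subset_term_le) (auto simp: m_def)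
  qed
  also have "\<dots> = 2 * exp 1 * d * (2 * real d / n) powr (1 / 8) * (\<Sum>j=1..min s n. j * (1 / 2) ^ (j - 1))"
    by (simp add: sum_distrib_left)
  also have "(\<Sum>j=1..min s n. real j * (1 / 2) ^ (j - 1)) = (\<Sum>j<min s n. real (Suc j) * (1 / 2) ^ j)"
    by (simp add: sum.atLeast1_atMost_eq)
  also have "2 * exp 1 * d * (2 * real d / n) powr (1 / 8) * \<dots> \<le> 2 * exp 1 * d * (2 * real d / n) powr (1 / 8) * 4"
    by (intro mult_left_mono sum_Suc_half_power_le) auto
  finally show ?thesis by simp
qed

text \<open>The bound mentions neither \<open>p\<close> nor \<open>d\<close>, so it tends to 0
  uniformly in both, and \<open>D\<close> is an absolute constant. In the proof \<open>k\<close> is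
  the least number with \<open>n \<le> k * exp d\<close>.\<close>

lemma prob_not_local_box_rep_le:
  "\<exists>D\<ge>1. \<forall>n p d. D \<le> d \<and> 1 \<le> n \<and> 0 \<le> p \<and> p \<le> 1 \<and> real n * p \<le> real d \<longrightarrow>
     measure_pmf.prob (random_graph n p) {E. E \<subseteq> all_edges {..<n} \<and> \<not> has_local_box_rep {..<n} E (8 * (16 * d) + 15)}
     \<le> 1 / n + 8 * exp 1 * ln n * (2 * ln n / n) powr (1 / 8)"
proof -
  \<comment> \<open>For \<open>1 < k\<close> one has \<open>k \<le> 2 * n * exp (- d)\<close>, so
    sets of size up to \<open>s = 17 * k * d\<close> give
    \<open>2 * s * d / n \<le> 68 * d ^ 2 * exp (- d)\<close>. Even under the eighth root the
    exponential beats the factor \<open>d\<close>.\<close>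
  have "\<forall>\<^sub>F x::real in at_top. 2 * exp 1 * x * (68 * x ^ 2 * exp (- x)) powr (1 / 8) \<le> 1 / 2"
    by real_asymp
  then obtain D\<^sub>0 where D\<^sub>0: "\<And>x. D\<^sub>0 \<le> x \<Longrightarrow> 2 * exp 1 * x * (68 * x ^ 2 * exp (- x)) powr (1 / 8) \<le> (1 / 2 :: real)"
    unfolding eventually_at_top_linorder by blast
  define D where "D = max 1 (nat \<lceil>D\<^sub>0\<rceil>)"
  have "measure_pmf.prob (random_graph n p) {E. E \<subseteq> all_edges {..<n} \<and> \<not> has_local_box_rep {..<n} E (8 * (16 * d) + 15)}
     \<le> 1 / n + 8 * exp 1 * ln n * (2 * ln n / n) powr (1 / 8)"
    if D: "D \<le> d" and n: "1 \<le> n" and p: "0 \<le> p" "p \<le> 1" "real n * p \<le> real d" for n d :: nat and p :: real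
  proof -
    let ?M = "random_graph n p"
    have d1: "1 \<le> d" using D by (simp add: D_def)
    have "D\<^sub>0 \<le> d" using D by (simp add: D_def)
    note half = D\<^sub>0[OF this]
    \<comment> \<open>With this \<open>k\<close>, if \<open>1 < k\<close> then \<open>d < ln n\<close>; otherwise there are no vertices of high degree.\<close>
    define k where "k = nat \<lceil>n * exp (- real d)\<rceil>"
    have npos: "0 < n * exp (- real d)" using n by simp
    have k1: "1 \<le> k" using npos by (simp add: k_def Suc_le_eq)
    have k_ge: "n * exp (- real d) \<le> k" unfolding k_def by (rule real_nat_ceiling_ge)
    then have n_le: "n \<le> k * exp d" by (simp add: exp_minus field_simps)
    have "n * exp (- real d) \<le> real n * 1" by (intro mult_left_mono) auto
    then have kn: "k \<le> n" by (simp add: k_def ceiling_le_iff)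
    define A where "A = {E. \<exists>S\<subseteq>{..<n}. card S = k \<and> 8 * k * d \<le> card (E \<inter> touching n S)}"
    define B where "B = {E. \<exists>S\<subseteq>{..<n}. S \<noteq> {} \<and> card S \<le> 17 * k * d \<and> 9 * card S \<le> 8 * card (E \<inter> all_edges S)}"
    have rep: "has_local_box_rep {..<n} E (8 * (16 * d) + 15)"
      if E: "E \<subseteq> all_edges {..<n}" "E \<notin> A" "1 < k \<Longrightarrow> E \<notin> B" for E
    proof (rule has_local_box_rep_if_sparse[OF E(1) d1 k1 kn])
      fix S assume "S \<subseteq> {..<n}" "card S = k"
      then show "card (E \<inter> touching n S) < 8 * k * d"
        using E(2) unfolding A_def by (metis (mono_tags, lifting) mem_Collect_eq not_le)
    next
      fix S assume "1 < k" "S \<subseteq> {..<n}" "S \<noteq> {}" "card S \<le> 17 * k * d"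
      then show "8 * card (E \<inter> all_edges S) < 9 * card S"
        using E(3) unfolding B_def by (metis (mono_tags, lifting) mem_Collect_eq not_le)
    qed
    have probA: "measure_pmf.prob ?M A \<le> 1 / n"
    proof -
      have "ln n \<le> ln (k * exp d)" using n_le n by (intro ln_mono) auto
      also have "\<dots> = ln k + d" using k1 by (simp add: ln_mult)
      also have "\<dots> \<le> real k + d" using ln_le_minus_one[of "real k"] k1 by simp
      also have "\<dots> \<le> 6 * real k * d"
      proof -
        have "real k * 1 \<le> real k * d" "1 * real d \<le> real k * d" using k1 d1 by (intro mult_mono; simp)+
        then show ?thesis by linarith
      qed
      finally have "exp (- 6 * real k * d) \<le> exp (- ln n)" by simp
      also have "\<dots> = 1 / n" using n by (simp add: exp_minus inverse_eq_divide)
      finally show ?thesis using prob_touching_le[OF p d1 k1 n_le] unfolding A_def by linarith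
    qed
    have ln0: "0 \<le> ln (real n)" using n by simp
    show ?thesis
    proof (cases "k = 1")
      case True
      have "{E. E \<subseteq> all_edges {..<n} \<and> \<not> has_local_box_rep {..<n} E (8 * (16 * d) + 15)} \<subseteq> A"
        using rep True by blast
      then have "measure_pmf.prob ?M {E. E \<subseteq> all_edges {..<n} \<and> \<not> has_local_box_rep {..<n} E (8 * (16 * d) + 15)}
          \<le> measure_pmf.prob ?M A" by (intro measure_pmf.finite_measure_mono) auto
      moreover have "0 \<le> 8 * exp 1 * ln n * (2 * ln n / n) powr (1 / 8)" using ln0 by simp
      ultimately show ?thesis using probA by linarith
    next
      case False
      have "1 < n * exp (- real d)"
      proof (rule ccontr)
        assume "\<not> 1 < n * exp (- real d)"
        then have "\<lceil>n * exp (- real d)\<rceil> \<le> 1" by (simp add: ceiling_le_iff)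
        then have "k \<le> 1" by (simp add: k_def)
        then show False using False k1 by simp
      qed
      then have gt: "exp d < n" by (simp add: exp_minus field_simps)
      then have "d < ln n" using ln_less_cancel_iff[of "exp d" n] n by simp
      then have d_ln: "d \<le> ln n" by simp
      have "k \<le> n * exp (- real d) + 1" unfolding k_def using npos by linarith
      then have "k \<le> 2 * (n * exp (- real d))" using \<open>1 < n * exp (- real d)\<close> by simp
      then have "34 * real d ^ 2 * real k \<le> 34 * real d ^ 2 * (2 * (n * exp (- real d)))" by (intro mult_left_mono) auto
      then have "2 * real (17 * k * d) * real d / n \<le> 68 * real d ^ 2 * exp (- real d)"
        using n by (simp add: pos_divide_le_eq power2_eq_square mult_ac)
      then have "2 * exp 1 * real d * (2 * real (17 * k * d) * d / n) powr (1 / 8)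
          \<le> 2 * exp 1 * real d * (68 * real d ^ 2 * exp (- real d)) powr (1 / 8)"
        by (intro mult_left_mono powr_mono2) auto
      also note half
      finally have "measure_pmf.prob ?M B \<le> 8 * exp 1 * d * (2 * real d / n) powr (1 / 8)"
        unfolding B_def using p d1 n by (intro prob_dense_subset_le) auto
      also have "\<dots> \<le> 8 * exp 1 * ln n * (2 * ln n / n) powr (1 / 8)"
        using d_ln ln0 by (intro mult_mono powr_mono2 divide_right_mono) auto
      finally have probB: "measure_pmf.prob ?M B \<le> 8 * exp 1 * ln n * (2 * ln n / n) powr (1 / 8)" .
      have "{E. E \<subseteq> all_edges {..<n} \<and> \<not> has_local_box_rep {..<n} E (8 * (16 * d) + 15)} \<subseteq> A \<union> B"
        using rep by blast
      then have "measure_pmf.prob ?M {E. E \<subseteq> all_edges {..<n} \<and> \<not> has_local_box_rep {..<n} E (8 * (16 * d) + 15)}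
          \<le> measure_pmf.prob ?M (A \<union> B)" by (intro measure_pmf.finite_measure_mono) auto
      also have "\<dots> \<le> measure_pmf.prob ?M A + measure_pmf.prob ?M B" by (rule measure_Un_le) auto
      finally show ?thesis using probA probB by linarith
    qed
  qed
  moreover have "1 \<le> D" by (simp add: D_def)
  ultimately show ?thesis by blast
qed

theorem theorem1p3:
  fixes \<epsilon> :: real
  assumes "\<epsilon> \<in> {0<..<1}"
  shows "\<exists>C\<^sub>4::real. \<forall>p::nat \<Rightarrow> real.
    (\<forall>n\<ge>1. real n * p n \<in> {1 - \<epsilon>..real n powr (1 - \<epsilon>)}) \<longrightarrow>
    (\<lambda>n. measure_pmf.prob (random_graph n (p n))
            {E. \<epsilon> / 41 * (real n * p n) \<le> real (lbox {..<n} E) \<and>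
                real (lbox {..<n} E) \<le> C\<^sub>4 * (real n * p n)}) \<longlonglongrightarrow> 1"
proof -
  have \<epsilon>: "0 < \<epsilon>" "\<epsilon> < 1" using assms by auto
  obtain D where "1 \<le> D" and D: "\<And>n p d. D \<le> d \<Longrightarrow> 1 \<le> n \<Longrightarrow> 0 \<le> p \<Longrightarrow> p \<le> 1 \<Longrightarrow> real n * p \<le> real d \<Longrightarrow>
     measure_pmf.prob (random_graph n p) {E. E \<subseteq> all_edges {..<n} \<and> \<not> has_local_box_rep {..<n} E (8 * (16 * d) + 15)}
     \<le> 1 / n + 8 * exp 1 * ln n * (2 * ln n / n) powr (1 / 8)"
    using prob_not_local_box_rep_le by blast
  \<comment> \<open>From \<open>d \<le> a + 1 + D\<close>, the bound
    \<open>8 * (16 * d) + 15\<close> is at most \<open>128 * a + 128 * (D + 1) + 15\<close>; as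
    \<open>a \<ge> 1 - \<epsilon>\<close>, the constant part is absorbed at the price of a factor
    \<open>a / (1 - \<epsilon>)\<close>.\<close>
  define C where "C = 128 + (128 * (real D + 1) + 15) / (1 - \<epsilon>)"
  define up where "up = (\<lambda>n::nat. 1 / real n + 8 * exp 1 * ln n * (2 * ln n / n) powr (1 / 8))"
  define low where "low = (\<lambda>n::nat. exp (- (1 - \<epsilon>) * (real n - 1) / 8) + exp (- \<epsilon> * (1 - \<epsilon>) * n * ln n / 25))"
  show ?thesis
  proof (intro exI[of _ C] allI impI)
    fix p :: "nat \<Rightarrow> real"
    assume np: "\<forall>n\<ge>1. real n * p n \<in> {1 - \<epsilon>..real n powr (1 - \<epsilon>)}"
    let ?prob = "\<lambda>n. measure_pmf.prob (random_graph n (p n))"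
    let ?G = "\<lambda>n. {E. \<epsilon> / 41 * (real n * p n) \<le> real (lbox {..<n} E) \<and>
                real (lbox {..<n} E) \<le> C * (real n * p n)}"
    have lower: "1 - up n - low n \<le> ?prob n (?G n)" if n: "41 \<le> n" for n
    proof -
      let ?M = "random_graph n (p n)"
      define a where "a = real n * p n"
      have a: "1 - \<epsilon> \<le> a" "a \<le> real n powr (1 - \<epsilon>)" using np n by (auto simp: a_def)
      have a0: "0 < a" using a \<epsilon> by linarith
      have "a \<le> real n powr 1"
        using n \<epsilon> by (intro order_trans[OF a(2)] powr_mono) auto
      then have p: "0 \<le> p n" "p n \<le> 1"
        using a0 n by (auto simp: a_def zero_less_mult_iff)
      define d where "d = nat \<lceil>a\<rceil> + D"
      define K where "K = 8 * (16 * d) + 15"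
      define L where "L = nat \<lfloor>\<epsilon> / 41 * a\<rfloor>"
      define B1 where "B1 = {E. E \<subseteq> all_edges {..<n} \<and> (\<exists>k\<le>L. has_local_box_rep {..<n} E k)}"
      define B2 where "B2 = {E. E \<subseteq> all_edges {..<n} \<and> \<not> has_local_box_rep {..<n} E K}"
      have "a \<le> real d" unfolding d_def by linarith
      then have B2: "?prob n B2 \<le> up n"
        unfolding B2_def up_def K_def using n p by (intro D) (auto simp: d_def a_def)
      have B1: "?prob n B1 \<le> low n"
        using prob_local_box_lower_le[OF \<epsilon> n, of "p n"] a n
        unfolding B1_def low_def L_def a_def by (simp add: of_nat_diff)
      have K: "real K \<le> C * a"
      proof -
        have "real d \<le> a + 1 + D" using a0 unfolding d_def by linarith
        then have "real K \<le> 128 * a + (128 * (real D + 1) + 15) * 1" by (simp add: K_def)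
        also have "\<dots> \<le> 128 * a + (128 * (real D + 1) + 15) * (a / (1 - \<epsilon>))"
          using a \<epsilon> by (intro add_left_mono mult_left_mono) auto
        also have "\<dots> = C * a" by (simp add: C_def field_simps)
        finally show ?thesis .
      qed
      have good: "E \<in> ?G n" if E: "E \<subseteq> all_edges {..<n}" "E \<notin> B1" "E \<notin> B2" for E
      proof -
        have rep: "has_local_box_rep {..<n} E K" using E by (auto simp: B2_def)
        have le: "lbox {..<n} E \<le> K" unfolding lbox_def by (rule Least_le) (rule rep)
        have "has_local_box_rep {..<n} E (lbox {..<n} E)" unfolding lbox_def by (rule LeastI) (rule rep)
        \<comment> \<open>\<open>lbox\<close> is itself a feasible number, some feasible number
          existing by \<open>rep\<close>; a value up to \<open>L\<close> would put \<open>E\<close>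
          into \<open>B1\<close>.\<close>
        then have "L < lbox {..<n} E" using E by (auto simp: B1_def not_le)
        then have "\<epsilon> / 41 * a < real (lbox {..<n} E)" unfolding L_def by linarith
        moreover have "real (lbox {..<n} E) \<le> C * a" using le K by linarith
        ultimately show ?thesis by (simp add: a_def)
      qed
      \<comment> \<open>Only edge sets on \<open>{..<n}\<close> are controlled, so the covering is
        claimed on the support of the distribution, which has full measure.\<close>
      have cover: "set_pmf ?M \<subseteq> ?G n \<union> (B1 \<union> B2)"
      proof
        fix E assume "E \<in> set_pmf ?M"
        then have E: "E \<subseteq> all_edges {..<n}" by (rule set_pmf_random_graph)
        show "E \<in> ?G n \<union> (B1 \<union> B2)"
        proof (cases "E \<in> B1 \<union> B2")
          case True
          then show ?thesis by (rule UnI2)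
        next
          case False
          with E have "E \<in> ?G n" by (intro good) simp_all
          then show ?thesis by (rule UnI1)
        qed
      qed
      have "1 = ?prob n (set_pmf ?M)" by (simp add: measure_pmf.prob_eq_1 AE_measure_pmf)
      also have "\<dots> \<le> ?prob n (?G n \<union> (B1 \<union> B2))"
        using cover by (rule measure_pmf.finite_measure_mono) simp
      also have "\<dots> \<le> ?prob n (?G n) + ?prob n (B1 \<union> B2)" by (rule measure_Un_le) auto
      also have "?prob n (B1 \<union> B2) \<le> ?prob n B1 + ?prob n B2" by (rule measure_Un_le) auto
      finally show ?thesis using B1 B2 by linarith
    qed
    have up: "up \<longlonglongrightarrow> 0" unfolding up_def by real_asymp
    have low: "low \<longlonglongrightarrow> 0" unfolding low_def using \<epsilon> by real_asymp
    have "(\<lambda>n. 1 - up n - low n) \<longlonglongrightarrow> 1 - 0 - 0" by (intro tendsto_diff up low tendsto_const)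
    then have lim: "(\<lambda>n. 1 - up n - low n) \<longlonglongrightarrow> 1" by simp
    show "(\<lambda>n. ?prob n (?G n)) \<longlonglongrightarrow> 1"
    proof (rule tendsto_sandwich[OF _ _ lim tendsto_const])
      show "\<forall>\<^sub>F n in sequentially. 1 - up n - low n \<le> ?prob n (?G n)"
        by (rule eventually_mono[OF eventually_ge_at_top[of 41]]) (rule lower)
    qed simp
  qed
qed

end
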